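(* Let $\pi = \lambda \oplus \rho$ where $\lambda$ and $\rho$ are permutations with $|\lambda| \ge 2$ and $|\rho| \ge 2$. Then the class $\operatorname{Av}(\pi)$ is not deflatable.
   Context: A permutation $\alpha$ is contained in $\beta$ if $\beta$ has a subsequence in the same relative order as $\alpha$; a class is a set of permutations closed under taking contained permutations; $\operatorname{Av}(\pi)$ is the class of permutations not containing $\pi$. $\alpha\oplus\beta$ is the permutation consisting of a copy of $\alpha$ followed by a copy of $\beta$ whose entries are all larger than those of the copy of $\alpha$. An interval of a permutation is a set of entries whose positions and values each form a set of consecutive integers, the whole permutation not counting as an interval; a permutation is simple if all its intervals are single entries (so $1$, $12$, $21$ are simple). A class $\mathcal{C}$ is deflatable if there is a proper subclass $\mathcal{D}\subsetneq\mathcal{C}$ with $\mathcal{C}\subseteq\langle\mathcal{D}\rangle$, where the substitution closure $\langle\mathcal{D}\rangle$ is the largest class whose simple permutations are exactly those of $\mathcal{D}$; equivalently, $\mathcal{C}$ is not deflatable if and only if every permutation in $\mathcal{C}$ is contained in some simple permutation belonging to $\mathcal{C}$. *)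

theory Defs
  imports "HOL-Library.Sublist" "HOL-Combinatorics.Multiset_Permutations"
begin

text \<open>A permutation of length \<open>n\<close> is given in one-line notation, as a list enumerating
  \<open>{1..n}\<close>. The empty permutation is admitted; it lies in every nonempty class.\<close>

definition is_perm :: "nat list \<Rightarrow> bool" where
  "is_perm xs \<longleftrightarrow> xs \<in> permutations_of_set {1..length xs}"

definition order_iso :: "nat list \<Rightarrow> nat list \<Rightarrow> bool" where
  "order_iso xs ys \<longleftrightarrow> length xs = length ys \<and>
     (\<forall>i<length xs. \<forall>j<length xs. xs ! i < xs ! j \<longleftrightarrow> ys ! i < ys ! j)"

definition contained_in :: "nat list \<Rightarrow> nat list \<Rightarrow> bool" where
  "contained_in \<alpha> \<beta> \<longleftrightarrow> (\<exists>\<gamma>. subseq \<gamma> \<beta> \<and> order_iso \<gamma> \<alpha>)"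

definition perm_class :: "nat list set \<Rightarrow> bool" where
  "perm_class C \<longleftrightarrow> (\<forall>\<beta>\<in>C. is_perm \<beta>) \<and>
     (\<forall>\<beta>\<in>C. \<forall>\<alpha>. is_perm \<alpha> \<longrightarrow> contained_in \<alpha> \<beta> \<longrightarrow> \<alpha> \<in> C)"

definition Av :: "nat list \<Rightarrow> nat list set" where
  "Av \<pi> = {\<beta>. is_perm \<beta> \<and> \<not> contained_in \<pi> \<beta>}"

definition perm_sum :: "nat list \<Rightarrow> nat list \<Rightarrow> nat list" (infixl "\<oplus>" 65) where
  "\<alpha> \<oplus> \<beta> = \<alpha> @ map (\<lambda>b. b + length \<alpha>) \<beta>"

text \<open>An interval is represented by its set \<open>I\<close> of (zero-based) positions. Intervals are
  nonempty and, by convention, different from the whole permutation.\<close>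

definition perm_interval :: "nat list \<Rightarrow> nat set \<Rightarrow> bool" where
  "perm_interval xs I \<longleftrightarrow> I \<noteq> {} \<and> I \<subset> {..<length xs} \<and>
     (\<exists>i j. I = {i..j}) \<and> (\<exists>a b. (\<lambda>k. xs ! k) ` I = {a..b})"

definition simple_perm :: "nat list \<Rightarrow> bool" where
  "simple_perm xs \<longleftrightarrow> is_perm xs \<and> (\<forall>I. perm_interval xs I \<longrightarrow> card I = 1)"

definition simples :: "nat list set \<Rightarrow> nat list set" where
  "simples C = {\<sigma>\<in>C. simple_perm \<sigma>}"

text \<open>The largest class with the same simple permutations as \<open>D\<close>, obtained as the union of all
  of them; lemma \<open>subst_closure_greatest\<close> confirms that this union is itself such a class.\<close>

definition subst_closure :: "nat list set \<Rightarrow> nat list set" where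
  "subst_closure D = \<Union>{E. perm_class E \<and> simples E = simples D}"

lemma subst_closure_greatest:
  assumes "perm_class D"
  shows "perm_class (subst_closure D)"
    and "simples (subst_closure D) = simples D"
    and "\<And>E. perm_class E \<Longrightarrow> simples E = simples D \<Longrightarrow> E \<subseteq> subst_closure D"
proof -
  show "perm_class (subst_closure D)"
    unfolding perm_class_def subst_closure_def by blast
  show "simples (subst_closure D) = simples D"
  proof
    show "simples (subst_closure D) \<subseteq> simples D"
      unfolding subst_closure_def simples_def by blast
    show "simples D \<subseteq> simples (subst_closure D)"
      using assms unfolding subst_closure_def simples_def by blast
  qed
  show "\<And>E. perm_class E \<Longrightarrow> simples E = simples D \<Longrightarrow> E \<subseteq> subst_closure D"
    unfolding subst_closure_def by blast
qed

definition deflatable :: "nat list set \<Rightarrow> bool" where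
  "deflatable C \<longleftrightarrow> (\<exists>D. perm_class D \<and> D \<subset> C \<and> C \<subseteq> subst_closure D)"

end

theory Submission imports Defs Complex_Main begin

text \<open>
  It suffices to embed every nonempty \<open>\<alpha> \<in> Av(\<pi>)\<close> into a simple member of \<open>Av(\<pi>)\<close>. A permutation is
  viewed as a finite set of points in the plane. If \<open>\<pi> = \<kappa> \<oplus> \<nu>\<close>, a new point with no copy of
  \<open>\<kappa>\<close> to its southwest and no copy of \<open>\<nu>\<close> to its northeast lies in no copy of \<open>\<pi>\<close>.

  First \<open>\<alpha>\<close> is made skew-indecomposable by linking its skew components, and then a leftmost and a
  topmost point are added that lie in no proper interval. Now let \<open>M\<close> be a maximal proper
  interval. If for some decomposition \<open>\<pi> = \<kappa> \<oplus> \<nu>\<close> a copy of \<open>\<kappa>\<close> lies southwest of \<open>M\<close>, then in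
  the column next to the first point of \<open>M\<close> there is a harmless place strictly below \<open>M\<close>
  and not adjacent to it, and inserting a point there splits \<open>M\<close>. The case of a copy of \<open>\<nu>\<close> northeast of
  \<open>M\<close> is symmetric. If neither occurs, three points inserted around the northwest corner of \<open>M\<close>
  split it without creating a copy of \<open>\<pi>\<close>; here \<open>|\<lambda>|, |\<rho>| \<ge> 2\<close> is needed, because removing one
  point from \<open>\<lambda>\<close> or \<open>\<rho>\<close> must leave a nonempty pattern. Every step decreases the number of
  points lying in proper intervals.
\<close>

section \<open>Point sets and patterns\<close>

type_synonym pt = "real \<times> real"

definition genpos :: "pt set \<Rightarrow> bool" where
  "genpos X \<longleftrightarrow> finite X \<and> inj_on fst X \<and> inj_on snd X"

definition southwest :: "pt set \<Rightarrow> pt set \<Rightarrow> bool" where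
  "southwest A B \<longleftrightarrow> (\<forall>a\<in>A. \<forall>b\<in>B. fst a < fst b \<and> snd a < snd b)"

text \<open>Injectivity of \<open>f\<close> is not demanded: when \<open>P\<close> is in general
  position, the strict comparisons force it (\<open>order_reflecting_inj\<close>).\<close>

definition occurrence :: "pt set \<Rightarrow> pt set \<Rightarrow> bool" where
  "occurrence P A \<longleftrightarrow> (\<exists>f. A = f ` P \<and> (\<forall>a\<in>P. \<forall>b\<in>P.
     (fst a < fst b \<longleftrightarrow> fst (f a) < fst (f b)) \<and> (snd a < snd b \<longleftrightarrow> snd (f a) < snd (f b))))"

definition avoids :: "pt set \<Rightarrow> pt set \<Rightarrow> bool" where
  "avoids P X \<longleftrightarrow> (\<forall>A\<subseteq>X. \<not> occurrence P A)"

definition interval :: "pt set \<Rightarrow> pt set \<Rightarrow> bool" where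
  "interval X J \<longleftrightarrow> J \<subseteq> X \<and> (\<forall>z\<in>X. \<forall>a\<in>J. \<forall>b\<in>J.
     fst a < fst z \<and> fst z < fst b \<or> snd a < snd z \<and> snd z < snd b \<longrightarrow> z \<in> J)"

definition proper_interval :: "pt set \<Rightarrow> pt set \<Rightarrow> bool" where
  "proper_interval X J \<longleftrightarrow> interval X J \<and> J \<noteq> X \<and> (\<exists>a\<in>J. \<exists>b\<in>J. a \<noteq> b)"

text \<open>This set is empty exactly when no proper interval exists, that is, when the points form
  a simple permutation. Its cardinality is the termination measure of the construction.\<close>

definition covered :: "pt set \<Rightarrow> pt set" where
  "covered X = \<Union>{J. proper_interval X J}"

section \<open>General position and basic facts on occurrences\<close>

lemma genpos_subset: "genpos X \<Longrightarrow> A \<subseteq> X \<Longrightarrow> genpos A"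
  unfolding genpos_def by (meson finite_subset inj_on_subset)

lemma genpos_fst_eq: "genpos X \<Longrightarrow> a \<in> X \<Longrightarrow> b \<in> X \<Longrightarrow> fst a = fst b \<longleftrightarrow> a = b"
  and genpos_snd_eq: "genpos X \<Longrightarrow> a \<in> X \<Longrightarrow> b \<in> X \<Longrightarrow> snd a = snd b \<longleftrightarrow> a = b"
  unfolding genpos_def inj_on_def by blast+

lemma genpos_insert:
  assumes "genpos X" and "\<And>z. z \<in> X \<Longrightarrow> fst z \<noteq> fst p" and "\<And>z. z \<in> X \<Longrightarrow> snd z \<noteq> snd p"
  shows "genpos (insert p X)"
  using assms unfolding genpos_def by (auto simp: inj_on_def dest!: sym[of "snd p"] sym[of "fst p"])

lemma order_reflecting_inj:
  fixes f :: "pt \<Rightarrow> pt"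
  assumes "genpos P" and "\<And>a b. a \<in> P \<Longrightarrow> b \<in> P \<Longrightarrow> fst a < fst b \<Longrightarrow> fst (f a) < fst (f b)"
  shows "inj_on f P"
proof (rule inj_onI)
  fix x y assume xy: "x \<in> P" "y \<in> P" "f x = f y"
  then have "\<not> fst x < fst y" "\<not> fst y < fst x" using assms(2) by (metis less_irrefl)+
  then show "x = y" using genpos_fst_eq[OF assms(1) xy(1,2)] by linarith
qed

lemma occurrence_card:
  assumes "genpos P" "occurrence P A"
  shows "card A = card P" "finite A"
proof -
  obtain f where f: "A = f ` P" "\<And>a b. a \<in> P \<Longrightarrow> b \<in> P \<Longrightarrow> fst a < fst b \<longleftrightarrow> fst (f a) < fst (f b)"
    using assms(2) unfolding occurrence_def by blast
  have "inj_on f P"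
    using f(2) by (intro order_reflecting_inj[OF assms(1)]) blast
  then show "card A = card P" using f(1) by (simp add: card_image)
  show "finite A" using f(1) assms(1) genpos_def by simp
qed

text \<open>\<open>southwest\<close> fixes every comparison between the two parts, in the pattern
  and in the copy alike, so the two embeddings can be glued.\<close>

lemma occurrence_join:
  assumes "occurrence K A" "occurrence N B" "southwest K N" "southwest A B"
  shows "occurrence (K \<union> N) (A \<union> B)"
proof -
  obtain f where f: "A = f ` K" "\<And>a b. a \<in> K \<Longrightarrow> b \<in> K \<Longrightarrow>
     (fst a < fst b \<longleftrightarrow> fst (f a) < fst (f b)) \<and> (snd a < snd b \<longleftrightarrow> snd (f a) < snd (f b))"
    using assms(1) unfolding occurrence_def by blast
  obtain g where g: "B = g ` N" "\<And>a b. a \<in> N \<Longrightarrow> b \<in> N \<Longrightarrow>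
     (fst a < fst b \<longleftrightarrow> fst (g a) < fst (g b)) \<and> (snd a < snd b \<longleftrightarrow> snd (g a) < snd (g b))"
    using assms(2) unfolding occurrence_def by blast
  have disj: "K \<inter> N = {}" using assms(3) unfolding southwest_def by fastforce
  define h where "h x = (if x \<in> K then f x else g x)" for x
  have hK: "h x = f x" if "x \<in> K" for x using that by (simp add: h_def)
  have hN: "h x = g x" if "x \<in> N" for x using that disj by (auto simp add: h_def)
  have "A \<union> B = h ` (K \<union> N)"
    unfolding f(1) g(1) image_Un using hK hN by (simp cong: image_cong)
  moreover have "(fst a < fst b \<longleftrightarrow> fst (h a) < fst (h b)) \<and> (snd a < snd b \<longleftrightarrow> snd (h a) < snd (h b))"
    if "a \<in> K \<union> N" "b \<in> K \<union> N" for a b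
  proof -
    have 1: "fst a < fst b \<and> snd a < snd b \<and> fst (h a) < fst (h b) \<and> snd (h a) < snd (h b)"
      if "a \<in> K" "b \<in> N" for a b
      using that assms(3,4) f(1) g(1) hK hN unfolding southwest_def by auto
    show ?thesis
      using that 1[of a b] 1[of b a] f(2)[of a b] g(2)[of a b] hK hN
      by (metis Un_iff order_less_asym)
  qed
  ultimately show ?thesis unfolding occurrence_def by blast
qed

lemma occurrence_split:
  assumes "occurrence (K \<union> N) C" "southwest K N"
  obtains A B where "C = A \<union> B" "occurrence K A" "occurrence N B" "southwest A B"
proof -
  obtain f where f: "C = f ` (K \<union> N)" "\<And>a b. a \<in> K \<union> N \<Longrightarrow> b \<in> K \<union> N \<Longrightarrow>
     (fst a < fst b \<longleftrightarrow> fst (f a) < fst (f b)) \<and> (snd a < snd b \<longleftrightarrow> snd (f a) < snd (f b))"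
    using assms(1) unfolding occurrence_def by blast
  have "occurrence K (f ` K)" "occurrence N (f ` N)" using f(2) unfolding occurrence_def by blast+
  moreover have "southwest (f ` K) (f ` N)" using f(2) assms(2) unfolding southwest_def by auto
  ultimately show ?thesis using that f(1) by (metis image_Un)
qed

text \<open>Serves to move a point across a decomposition: for \<open>P = K \<union> N\<close>, the
  point \<open>k\<close> can be shifted into the second summand, and \<open>A - {d}\<close> is then
  a copy of the first summand of another decomposition of \<open>P\<close>.\<close>

lemma occurrence_remove_last:
  assumes "genpos K" "occurrence K A" "d \<in> A" "southwest (A - {d}) {d}"
  obtains k where "k \<in> K" "southwest (K - {k}) {k}" "occurrence (K - {k}) (A - {d})"
proof -
  obtain f where f: "A = f ` K" "\<And>a b. a \<in> K \<Longrightarrow> b \<in> K \<Longrightarrow>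
     (fst a < fst b \<longleftrightarrow> fst (f a) < fst (f b)) \<and> (snd a < snd b \<longleftrightarrow> snd (f a) < snd (f b))"
    using assms(2) unfolding occurrence_def by blast
  obtain k where k: "k \<in> K" "d = f k" using assms(3) f(1) by blast
  have inj: "inj_on f K"
    using f(2) by (intro order_reflecting_inj[OF assms(1)]) blast
  have im: "A - {d} = f ` (K - {k})" using inj k f(1) by (auto simp: inj_on_def)
  have "southwest (K - {k}) {k}" using assms(4) f(2) k unfolding im southwest_def by auto
  moreover have "occurrence (K - {k}) (A - {d})" using im f(2) unfolding occurrence_def by blast
  ultimately show ?thesis using that k(1) by blast
qed

text \<open>Dual to \<open>occurrence_remove_last\<close>: it lets the least point of a second
  summand be shifted into the first.\<close>

lemma occurrence_remove_first:
  assumes "genpos K" "occurrence K A" "d \<in> A" "southwest {d} (A - {d})"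
  obtains k where "k \<in> K" "southwest {k} (K - {k})" "occurrence (K - {k}) (A - {d})"
proof -
  obtain f where f: "A = f ` K" "\<And>a b. a \<in> K \<Longrightarrow> b \<in> K \<Longrightarrow>
     (fst a < fst b \<longleftrightarrow> fst (f a) < fst (f b)) \<and> (snd a < snd b \<longleftrightarrow> snd (f a) < snd (f b))"
    using assms(2) unfolding occurrence_def by blast
  obtain k where k: "k \<in> K" "d = f k" using assms(3) f(1) by blast
  have inj: "inj_on f K"
    using f(2) by (intro order_reflecting_inj[OF assms(1)]) blast
  have im: "A - {d} = f ` (K - {k})" using inj k f(1) by (auto simp: inj_on_def)
  have "southwest {k} (K - {k})" using assms(4) f(2) k unfolding im southwest_def by auto
  moreover have "occurrence (K - {k}) (A - {d})" using im f(2) unfolding occurrence_def by blast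
  ultimately show ?thesis using that k(1) by blast
qed

text \<open>Reflection in the antidiagonal exchanges the roles of the two summands of a pattern, and of
  the horizontal and the vertical direction, while fixing the northwest corner.\<close>

definition flip :: "pt \<Rightarrow> pt" where
  "flip p = (- snd p, - fst p)"

lemma fst_flip [simp]: "fst (flip p) = - snd p"
  and snd_flip [simp]: "snd (flip p) = - fst p"
  and flip_flip [simp]: "flip (flip p) = p"
  by (simp_all add: flip_def)

lemma flip_eq_iff [simp]: "flip p = flip q \<longleftrightarrow> p = q"
  by (metis flip_flip)

lemma flip_image_flip_image [simp]: "flip ` flip ` X = X"
  by (simp add: image_image)

lemma flip_image_subset_iff [simp]: "flip ` X \<subseteq> flip ` Y \<longleftrightarrow> X \<subseteq> Y"
  by (simp add: inj_image_subset_iff inj_def)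

lemma flip_image_eq_iff [simp]: "flip ` X = flip ` Y \<longleftrightarrow> X = Y"
  by (simp add: inj_image_eq_iff inj_def)

lemma flip_mem_image [simp]: "flip p \<in> flip ` X \<longleftrightarrow> p \<in> X"
  by auto

lemma card_flip [simp]: "card (flip ` X) = card X"
  by (simp add: card_image inj_on_def)

lemma genpos_flip [simp]: "genpos (flip ` X) \<longleftrightarrow> genpos X"
proof -
  have "genpos (flip ` X)" if "genpos X" for X
    using that unfolding genpos_def inj_on_def by simp
  from this[of X] this[of "flip ` X"] show ?thesis by auto
qed

lemma southwest_flip [simp]: "southwest (flip ` A) (flip ` B) \<longleftrightarrow> southwest B A"
  unfolding southwest_def by auto

lemma occurrence_flip [simp]: "occurrence (flip ` P) (flip ` A) \<longleftrightarrow> occurrence P A"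
proof -
  have "occurrence (flip ` P) (flip ` A)" if "occurrence P A" for P A
  proof -
    obtain f where f: "A = f ` P" "\<And>a b. a \<in> P \<Longrightarrow> b \<in> P \<Longrightarrow>
      (fst a < fst b \<longleftrightarrow> fst (f a) < fst (f b)) \<and> (snd a < snd b \<longleftrightarrow> snd (f a) < snd (f b))"
      using \<open>occurrence P A\<close> unfolding occurrence_def by blast
    then show ?thesis unfolding occurrence_def
      by (intro exI[of _ "\<lambda>x. flip (f (flip x))"]) (auto simp: image_image)
  qed
  from this[of P A] this[of "flip ` P" "flip ` A"] show ?thesis by auto
qed

lemma ex_flip_set: "(\<exists>A. P A) \<longleftrightarrow> (\<exists>A. P (flip ` A))"
  by (metis flip_image_flip_image)

lemma avoids_flip [simp]: "avoids (flip ` P) (flip ` X) \<longleftrightarrow> avoids P X"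
proof -
  have "(\<exists>A. A \<subseteq> flip ` X \<and> occurrence (flip ` P) A) \<longleftrightarrow> (\<exists>A. A \<subseteq> X \<and> occurrence P A)"
    by (subst ex_flip_set) simp
  then show ?thesis unfolding avoids_def by blast
qed

lemma interval_flip [simp]: "interval (flip ` X) (flip ` J) \<longleftrightarrow> interval X J"
  unfolding interval_def by auto

lemma proper_interval_flip [simp]: "proper_interval (flip ` X) (flip ` J) \<longleftrightarrow> proper_interval X J"
  unfolding proper_interval_def by auto

lemma covered_flip [simp]: "covered (flip ` X) = flip ` covered X"
proof -
  have "flip ` covered X \<subseteq> covered (flip ` X)" for X
  proof
    fix z assume "z \<in> flip ` covered X"
    then obtain J where "proper_interval X J" "z \<in> flip ` J" unfolding covered_def by auto
    then show "z \<in> covered (flip ` X)" unfolding covered_def using proper_interval_flip by blast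
  qed
  from this[of X] this[of "flip ` X"] show ?thesis
    by (metis flip_image_flip_image flip_image_subset_iff subset_antisym)
qed

section \<open>Intervals and one-point cuts\<close>

text \<open>Stronger than maximality under inclusion: no interval other than \<open>X\<close> may
  overlap \<open>M\<close> without lying inside it.\<close>

definition maximal_interval :: "pt set \<Rightarrow> pt set \<Rightarrow> bool" where
  "maximal_interval X M \<longleftrightarrow> proper_interval X M \<and>
     (\<forall>J. interval X J \<and> J \<inter> M \<noteq> {} \<longrightarrow> J \<subseteq> M \<or> J = X)"

lemma proper_interval_subset_covered: "proper_interval X J \<Longrightarrow> J \<subseteq> covered X"
  unfolding covered_def by blast

lemma covered_subset: "covered X \<subseteq> X"
  unfolding covered_def proper_interval_def interval_def by blast

lemma maximal_intervalD:
  assumes "maximal_interval X M"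
  shows "M \<subseteq> X" "M \<noteq> X" "interval X M" "\<exists>a\<in>M. \<exists>b\<in>M. a \<noteq> b" "M \<subseteq> covered X"
proof -
  have M: "proper_interval X M" using assms by (simp add: maximal_interval_def)
  then show "M \<noteq> X" "interval X M" "\<exists>a\<in>M. \<exists>b\<in>M. a \<noteq> b" by (simp_all add: proper_interval_def)
  then show "M \<subseteq> X" by (simp add: interval_def)
  show "M \<subseteq> covered X" by (rule proper_interval_subset_covered[OF M])
qed

text \<open>A point between \<open>a\<close> in one interval and \<open>b\<close> in the other lies
  on one side of a common point \<open>c\<close>, hence between \<open>c\<close> and one of
  \<open>a\<close>, \<open>b\<close>.\<close>

lemma interval_Un:
  assumes "genpos X" "interval X I" "interval X J" "I \<inter> J \<noteq> {}"
  shows "interval X (I \<union> J)"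
proof -
  obtain c where c: "c \<in> I" "c \<in> J" using assms(4) by blast
  have sub: "I \<subseteq> X" "J \<subseteq> X" using assms(2,3) unfolding interval_def by blast+
  have key: "z \<in> I' \<union> J'" if "z \<in> X" "a \<in> I'" "b \<in> J'" "c \<in> I'" "c \<in> J'" "interval X I'" "interval X J'"
    "fst a < fst z \<and> fst z < fst b \<or> snd a < snd z \<and> snd z < snd b" for z a b I' J'
  proof (cases "z = c")
    case False
    have "c \<in> X" using c sub by blast
    then have "fst z \<noteq> fst c" "snd z \<noteq> snd c"
      using False genpos_fst_eq genpos_snd_eq assms(1) that(1) by metis+
    then show ?thesis using that unfolding interval_def by (meson UnI1 UnI2 linorder_neqE)
  qed (use that in auto)
  show ?thesis unfolding interval_def
  proof (intro conjI ballI impI)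
    show "I \<union> J \<subseteq> X" using sub by blast
  next
    fix z a b assume z: "z \<in> X" "a \<in> I \<union> J" "b \<in> I \<union> J"
      and h: "fst a < fst z \<and> fst z < fst b \<or> snd a < snd z \<and> snd z < snd b"
    consider "a \<in> I" "b \<in> J" | "a \<in> J" "b \<in> I" | "a \<in> I" "b \<in> I" | "a \<in> J" "b \<in> J"
      using z by blast
    then show "z \<in> I \<union> J"
    proof cases
      case 1 then show ?thesis using key[OF z(1) _ _ c assms(2,3) h] by blast
    next
      case 2 then show ?thesis using key[OF z(1) _ _ c(2,1) assms(3,2) h] by blast
    next
      case 3 then show ?thesis using assms(2) z(1) h unfolding interval_def by blast
    next
      case 4 then show ?thesis using assms(3) z(1) h unfolding interval_def by blast
    qed
  qed
qed

text \<open>An inclusion-maximal proper interval serves: its union with an overlapping proper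
  interval is again an interval, and differs from \<open>X\<close> because it misses an uncovered
  point.\<close>

lemma ex_maximal_interval:
  assumes "genpos X" "covered X \<noteq> {}" "X - covered X \<noteq> {}"
  shows "\<exists>M. maximal_interval X M"
proof -
  have fin: "finite X" using assms(1) by (simp add: genpos_def)
  let ?S = "{J. proper_interval X J}"
  have "?S \<subseteq> Pow X" unfolding proper_interval_def interval_def by blast
  then have "finite ?S" using fin by (meson finite_Pow_iff finite_subset)
  moreover have "?S \<noteq> {}" using assms(2) unfolding covered_def by blast
  ultimately obtain M where M: "M \<in> ?S" "\<And>J. J \<in> ?S \<Longrightarrow> M \<subseteq> J \<Longrightarrow> J = M"
    using finite_has_maximal[of ?S] by metis
  obtain g where g: "g \<in> X" "g \<notin> covered X" using assms(3) by blast
  have "J \<subseteq> M \<or> J = X" if J: "interval X J" "J \<inter> M \<noteq> {}" for J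
  proof (rule ccontr)
    assume neg: "\<not> (J \<subseteq> M \<or> J = X)"
    then have "\<exists>a\<in>J. \<exists>b\<in>J. a \<noteq> b" using J(2) by (metis disjoint_iff subsetI)
    then have "proper_interval X J" using J neg unfolding proper_interval_def by blast
    then have "g \<notin> J" "g \<notin> M" using g(2) M(1) proper_interval_subset_covered by blast+
    moreover have "interval X (J \<union> M)"
      using J M(1) assms(1) by (intro interval_Un) (auto simp: proper_interval_def)
    ultimately have "proper_interval X (J \<union> M)"
      using g(1) M(1) unfolding proper_interval_def by blast
    then show False using M(2)[of "J \<union> M"] neg by blast
  qed
  then show ?thesis using M(1) unfolding maximal_interval_def by blast
qed

lemma maximal_interval_flip [simp]:
  "maximal_interval (flip ` X) (flip ` M) \<longleftrightarrow> maximal_interval X M"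
proof -
  have "maximal_interval (flip ` X) (flip ` M)" if "maximal_interval X M" for X M
    unfolding maximal_interval_def
  proof (intro conjI allI impI)
    show "proper_interval (flip ` X) (flip ` M)" using that by (simp add: maximal_interval_def)
  next
    fix J assume "interval (flip ` X) J \<and> J \<inter> flip ` M \<noteq> {}"
    then have "interval X (flip ` J)" "flip ` J \<inter> M \<noteq> {}"
      by (metis flip_image_flip_image interval_flip, force)
    then have "flip ` J \<subseteq> M \<or> flip ` J = X" using that by (simp add: maximal_interval_def)
    then show "J \<subseteq> flip ` M \<or> J = flip ` X" by (metis flip_image_flip_image flip_image_subset_iff)
  qed
  from this[of X M] this[of "flip ` X" "flip ` M"] show ?thesis by auto
qed

lemma interval_restrict: "interval Y J \<Longrightarrow> X \<subseteq> Y \<Longrightarrow> interval X (J \<inter> X)"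
  unfolding interval_def by blast

lemma interval_fstD: "interval X J \<Longrightarrow> a \<in> J \<Longrightarrow> b \<in> J \<Longrightarrow> z \<in> X \<Longrightarrow> fst a < fst z \<Longrightarrow> fst z < fst b \<Longrightarrow> z \<in> J"
  and interval_sndD: "interval X J \<Longrightarrow> a \<in> J \<Longrightarrow> b \<in> J \<Longrightarrow> z \<in> X \<Longrightarrow> snd a < snd z \<Longrightarrow> snd z < snd b \<Longrightarrow> z \<in> J"
  unfolding interval_def by blast+

text \<open>The trace of \<open>J\<close> on \<open>X\<close> is an interval of \<open>X\<close>
  that meets \<open>M\<close> and leaves it, so it is all of \<open>X\<close>.\<close>

lemma maximal_interval_spread:
  assumes "maximal_interval X M" "X \<subseteq> Y" "interval Y J" "m \<in> J" "m \<in> M" "w \<in> J" "w \<in> X" "w \<notin> M"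
  shows "X \<subseteq> J"
proof -
  have "m \<in> X" using assms(1,5) unfolding maximal_interval_def proper_interval_def interval_def by blast
  then have "J \<inter> X \<inter> M \<noteq> {}" "\<not> J \<inter> X \<subseteq> M" using assms by blast+
  then have "J \<inter> X = X"
    using assms(1) interval_restrict[OF assms(3,2)] unfolding maximal_interval_def by blast
  then show ?thesis by blast
qed

lemma ex_least:
  fixes g :: "pt \<Rightarrow> real"
  assumes "finite S" "S \<noteq> {}"
  shows "\<exists>x\<in>S. \<forall>y\<in>S. g x \<le> g y"
  using arg_min_if_finite(1)[OF assms, of g] arg_min_least[OF assms, of _ g] by blast

lemma ex_greatest:
  fixes g :: "pt \<Rightarrow> real"
  assumes "finite S" "S \<noteq> {}"
  shows "\<exists>x\<in>S. \<forall>y\<in>S. g y \<le> g x"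
  using ex_least[OF assms, of "\<lambda>x. - g x"] by simp

text \<open>Supplies coordinates for new points: two fresh values in the empty strip just below
  \<open>c\<close>.\<close>

lemma gap_left:
  fixes c :: real
  assumes "finite X"
  shows "\<exists>a b. a < b \<and> b < c \<and> (\<forall>z\<in>X. g z < c \<longrightarrow> g z < a)"
proof -
  \<comment> \<open>The value \<open>c - 1\<close> keeps the maximum over a nonempty set when no
    point lies below \<open>c\<close>.\<close>
  define m where "m = Max (insert (c - 1) {v \<in> g ` X. v < c})"
  have fin: "finite (insert (c - 1) {v \<in> g ` X. v < c})" using assms by simp
  have m1: "m < c" unfolding m_def by (subst Max_less_iff[OF fin]) auto
  have m2: "g z \<le> m" if "z \<in> X" "g z < c" for z
    unfolding m_def using that by (intro Max_ge[OF fin]) auto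
  obtain a where a: "m < a" "a < c" using dense[OF m1] by blast
  obtain b where b: "a < b" "b < c" using dense[OF a(2)] by blast
  have "g z < a" if "z \<in> X" "g z < c" for z using m2[OF that] a(1) by linarith
  then show ?thesis using b by blast
qed

lemma gap_right:
  fixes c :: real
  assumes "finite X"
  shows "\<exists>a b. c < a \<and> a < b \<and> (\<forall>z\<in>X. c < g z \<longrightarrow> b < g z)"
proof -
  obtain a b where ab: "a < b" "b < - c" "\<forall>z\<in>X. - g z < - c \<longrightarrow> - g z < a"
    using gap_left[OF assms, of "- c" "\<lambda>z. - g z"] by blast
  have "c < - b \<and> - b < - a \<and> (\<forall>z\<in>X. c < g z \<longrightarrow> - a < g z)" using ab by fastforce
  then show ?thesis by blast
qed

section \<open>Extensions that shrink the covered set\<close>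

definition extendable :: "pt set \<Rightarrow> pt set \<Rightarrow> bool" where
  "extendable P X \<longleftrightarrow> (\<exists>Y. X \<subseteq> Y \<and> genpos Y \<and> avoids P Y \<and> covered Y \<subset> covered X)"

lemma extendable_flip:
  assumes "extendable (flip ` P) (flip ` X)"
  shows "extendable P X"
proof -
  obtain Z where Z: "flip ` X \<subseteq> Z" "genpos Z" "avoids (flip ` P) Z" "covered Z \<subset> covered (flip ` X)"
    using assms unfolding extendable_def by blast
  define Y where "Y = flip ` Z"
  have ZY: "Z = flip ` Y" by (simp add: Y_def)
  have "X \<subseteq> Y" "genpos Y" "avoids P Y" "covered Y \<subset> covered X"
    using Z unfolding ZY psubset_eq by simp_all
  then show ?thesis unfolding extendable_def by blast
qed

text \<open>By the last hypothesis a proper interval of \<open>Y\<close> has only old points, so it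
  is an interval of \<open>X\<close>. Since it misses \<open>s\<close>, it is proper in
  \<open>X\<close>, and \<open>s\<close> is no longer covered.\<close>

lemma covered_psubset:
  assumes "s \<in> covered X" "X \<subseteq> Y" "s \<in> S"
    and "\<And>J. proper_interval Y J \<Longrightarrow> J \<inter> S = {} \<and> J \<subseteq> X"
  shows "covered Y \<subset> covered X"
proof -
  have sX: "s \<in> X" using assms(1) covered_subset by blast
  have "J \<subseteq> covered X - {s}" if J: "proper_interval Y J" for J
  proof -
    have "s \<notin> J" using assms(3,4) J by blast
    have "interval X J"
      using interval_restrict[of Y J X] assms(2) assms(4)[OF J] J
      by (auto simp: proper_interval_def inf_absorb1)
    then have "proper_interval X J" using J sX \<open>s \<notin> J\<close> unfolding proper_interval_def by blast
    then show ?thesis using proper_interval_subset_covered \<open>s \<notin> J\<close> by blast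
  qed
  then have "covered Y \<subseteq> covered X - {s}" unfolding covered_def[of Y] by blast
  then show ?thesis using assms(1) by blast
qed

text \<open>The new point \<open>p\<close> separates \<open>s\<close> from the rest of
  \<open>M\<close> by its column. It lies in no copy of \<open>P\<close>: a copy of \<open>K\<close>
  southwest of it would be too low, and a copy of \<open>N\<close> northeast of it would complete an
  old copy of \<open>K\<close>. The point \<open>w\<close>, in a row between \<open>p\<close> and
  \<open>M\<close>, prevents \<open>p\<close> from joining \<open>M\<close> in a larger proper
  interval.\<close>

lemma vertical_cut:
  assumes X: "genpos X" and P: "genpos P" and av: "avoids P X"
    and cut: "P = K \<union> N" "southwest K N" "K \<noteq> {}"
    and A: "A \<subseteq> X" "occurrence K A" "southwest A M" and M: "maximal_interval X M"
  shows "extendable P X"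
proof -
  have finX: "finite X" using X by (simp add: genpos_def)
  note Mprop = maximal_intervalD[OF M]
  note MX = Mprop(1,2) and Mint = Mprop(3) and Mtwo = Mprop(4) and Mcov = Mprop(5)
  have finM: "finite M" "M \<noteq> {}" using finX MX Mtwo finite_subset by blast+
  have K: "genpos K" "card K > 0"
    using P cut genpos_subset[of P K] by (auto simp: card_gt_0_iff genpos_def)
  have occK: "finite C \<and> C \<noteq> {}" if "occurrence K C" for C
    using occurrence_card[OF K(1) that] K(2) by auto
  obtain s where s: "s \<in> M" "\<And>z. z \<in> M \<Longrightarrow> fst s \<le> fst z"
    using ex_least[OF finM, of fst] by blast
  obtain x0 where x0: "fst s < x0" "\<And>z. z \<in> X \<Longrightarrow> fst s < fst z \<Longrightarrow> x0 < fst z"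
    using gap_right[OF finX, of "fst s" fst] by (meson less_trans)
  \<comment> \<open>The new point goes just below the lowest row at which \<open>K\<close> appears in its column.\<close>
  define T where "T = {w \<in> X. fst w < x0 \<and> (\<exists>C. occurrence K C \<and> C \<subseteq> {z \<in> X. fst z < x0 \<and> snd z \<le> snd w})}"
  \<comment> \<open>The witness is the highest point of \<open>C\<close>.\<close>
  have Tmem: "\<exists>w\<in>T. w \<in> C" if C: "occurrence K C" "C \<subseteq> X" "\<And>z. z \<in> C \<Longrightarrow> fst z < x0" for C
  proof -
    have "finite C" "C \<noteq> {}" using occK[OF C(1)] by blast+
    then obtain w where "w \<in> C" "\<And>y. y \<in> C \<Longrightarrow> snd y \<le> snd w"
      using ex_greatest[of C snd] by blast
    then show ?thesis using C unfolding T_def by blast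
  qed
  have "fst z < x0" if "z \<in> A" for z using A(3) that s(1) x0(1) unfolding southwest_def by fastforce
  then obtain wA where wA: "wA \<in> T" "wA \<in> A" using Tmem[OF A(2,1)] by blast
  have "finite T" unfolding T_def using finX by simp
  moreover have "T \<noteq> {}" using wA(1) by blast
  ultimately obtain w where w: "w \<in> T" "\<And>y. y \<in> T \<Longrightarrow> snd w \<le> snd y"
    using ex_least[of T snd] by blast
  obtain C where C: "occurrence K C" "C \<subseteq> {z \<in> X. fst z < x0 \<and> snd z \<le> snd w}"
    using w(1) unfolding T_def by blast
  have wX: "w \<in> X" "fst w < x0" using w(1) unfolding T_def by blast+
  have wM: "snd w < snd z" if "z \<in> M" for z
    using w(2)[OF wA(1)] A(3) wA(2) that unfolding southwest_def by fastforce
  obtain y where y: "y < snd w" "\<And>z. z \<in> X \<Longrightarrow> snd z < snd w \<Longrightarrow> snd z < y"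
    using gap_left[OF finX, of "snd w" snd] by (meson less_trans)
  define p where "p = (x0, y)"
  define Y where "Y = insert p X"
  have Y: "genpos Y" unfolding Y_def
  proof (rule genpos_insert[OF X])
    show "fst z \<noteq> fst p" if "z \<in> X" for z using x0(1) x0(2)[OF that] unfolding p_def by auto
    show "snd z \<noteq> snd p" if "z \<in> X" for z using y(1) y(2)[OF that] unfolding p_def by auto
  qed
  have avY: "avoids P Y" unfolding avoids_def
  proof (intro allI impI notI)
    fix D assume D: "D \<subseteq> Y" "occurrence P D"
    obtain E F where EF: "D = E \<union> F" "occurrence K E" "occurrence N F" "southwest E F"
      using occurrence_split D(2) cut(1,2) by metis
    have "p \<in> D" using D av unfolding avoids_def Y_def by blast
    then consider "p \<in> E" | "p \<in> F" using EF(1) by blast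
    then show False
    proof cases
      case 1
      have F: "z \<in> X \<and> x0 < fst z \<and> y < snd z" if "z \<in> F" for z
      proof -
        have "fst p < fst z \<and> snd p < snd z" using 1 EF(4) that unfolding southwest_def by blast
        then show ?thesis using D(1) EF(1) that unfolding Y_def p_def by auto
      qed
      \<comment> \<open>No point of \<open>X\<close> has a height in the gap from \<open>y\<close>
        up to \<open>w\<close>, and \<open>w\<close> is left of \<open>F\<close>. So
        \<open>C\<close> can replace \<open>E\<close>, which gives a copy of \<open>P\<close> inside
        \<open>X\<close>.\<close>
      have "snd w < snd z" if "z \<in> F" for z
      proof -
        have "z \<noteq> w" using F[OF that] wX(2) by auto
        then have "snd z \<noteq> snd w" using genpos_snd_eq[OF X] F[OF that] wX(1) by blast
        then show ?thesis using y(2)[of z] F[OF that] by linarith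
      qed
      then have "southwest C F" using C(2) F unfolding southwest_def by fastforce
      then have "occurrence P (C \<union> F)" using occurrence_join C(1) EF(3) cut(1,2) by blast
      then show False using av C(2) F unfolding avoids_def by blast
    next
      case 2
      have E: "z \<in> X \<and> fst z < x0 \<and> snd z < y" if "z \<in> E" for z
      proof -
        have "fst z < fst p \<and> snd z < snd p" using 2 EF(4) that unfolding southwest_def by blast
        then show ?thesis using D(1) EF(1) that unfolding Y_def p_def by auto
      qed
      \<comment> \<open>The copy \<open>E\<close> of \<open>K\<close> lies below \<open>y\<close>,
        although \<open>w\<close> is a lowest point of \<open>T\<close>.\<close>
      obtain v where "v \<in> T" "v \<in> E" using Tmem[OF EF(2)] E by blast
      then show False using w(2)[of v] E[of v] y(1) by linarith
    qed
  qed
  have wnM: "w \<notin> M" using wM by blast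
  have all: "J = Y" if J: "interval Y J" "p \<in> J" "m \<in> J" "m \<in> M" for J m
  proof -
    have JY: "J \<subseteq> Y" using J(1) unfolding interval_def by blast
    have "w \<in> J"
      using interval_sndD[OF J(1,2,3), of w] wX(1) y(1) wM[OF J(4)] unfolding Y_def p_def by simp
    then have "X \<subseteq> J"
      using maximal_interval_spread[OF M _ J(1) J(3,4) _ wX(1) wnM] unfolding Y_def by blast
    then show ?thesis using J(2) JY unfolding Y_def by blast
  qed
  have sY: "s \<in> Y" using s(1) MX unfolding Y_def by blast
  \<comment> \<open>Any second point of \<open>J\<close> brings a point of \<open>M\<close> into
    \<open>J\<close>: on the left of \<open>p\<close> it forces \<open>s\<close>, and on the right
    either it lies in \<open>M\<close> itself or it forces the second point \<open>s2\<close> of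
    \<open>M\<close>.\<close>
  have no: "p \<notin> J" if J: "proper_interval Y J" for J
  proof
    assume p: "p \<in> J"
    have Jint: "interval Y J" "J \<noteq> Y" "J \<subseteq> Y" using J unfolding proper_interval_def interval_def by blast+
    obtain z where z: "z \<in> J" "z \<noteq> p" using J unfolding proper_interval_def by metis
    then have zX: "z \<in> X" using Jint(3) unfolding Y_def by blast
    show False
    proof (cases "fst s < fst z")
      case False
      have "s \<in> J"
      proof (cases "z = s")
        case False
        then have "fst z < fst s" using \<open>\<not> fst s < fst z\<close> genpos_fst_eq[OF X zX] s(1) MX by fastforce
        then show ?thesis using interval_fstD[OF Jint(1) z(1) p sY] x0(1) unfolding p_def by simp
      qed (use z in simp)
      then show False using all[OF Jint(1) p _ s(1)] Jint(2) by blast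
    next
      case True
      have "finite (M - {s})" "M - {s} \<noteq> {}" using finM(1) Mtwo by blast+
      then obtain s2 where s2: "s2 \<in> M" "s2 \<noteq> s" "\<And>y. y \<in> M \<Longrightarrow> y \<noteq> s \<Longrightarrow> fst s2 \<le> fst y"
        using ex_least[of "M - {s}" fst] by blast
      have s2s: "fst s < fst s2" using s(2)[OF s2(1)] s2(2) genpos_fst_eq[OF X, of s s2] s(1) s2(1) MX by fastforce
      have s2X: "s2 \<in> X" using s2(1) MX by blast
      have "\<exists>m\<in>M. m \<in> J"
      proof (cases "fst z < fst s2")
        case True
        then have "z \<in> M" using interval_fstD[OF Mint s(1) s2(1) zX] \<open>fst s < fst z\<close> by blast
        then show ?thesis using z by blast
      next
        case False
        show ?thesis
        proof (cases "z = s2")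
          case False
          then have "fst s2 < fst z" using \<open>\<not> fst z < fst s2\<close> genpos_fst_eq[OF X zX s2X] by fastforce
          then show ?thesis
            using interval_fstD[OF Jint(1) p z(1), of s2] x0(2)[OF s2X s2s] s2X s2(1) unfolding Y_def p_def by auto
        qed (use z s2 in blast)
      qed
      then show False using all[OF Jint(1) p] Jint(2) by blast
    qed
  qed
  have "covered Y \<subset> covered X"
  proof (rule covered_psubset[of s X Y "{p, s}"])
    show "s \<in> covered X" using s(1) Mcov by blast
    fix J assume J: "proper_interval Y J"
    have Jint: "interval Y J" "J \<noteq> Y" using J unfolding proper_interval_def by blast+
    have JX: "J \<subseteq> X" using no[OF J] Jint unfolding interval_def Y_def by blast
    \<comment> \<open>Whether \<open>J\<close> lies inside \<open>M\<close> or equals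
      \<open>X\<close>, it has a second point of \<open>M\<close>; the column of \<open>p\<close> is
      caught between that point and \<open>s\<close>.\<close>
    have "s \<notin> J"
    proof
      assume sJ: "s \<in> J"
      have "interval X J" using interval_restrict[OF Jint(1), of X] JX unfolding Y_def by (auto simp: inf_absorb1)
      then have "J \<subseteq> M \<or> J = X" using M sJ s(1) unfolding maximal_interval_def by blast
      moreover obtain z where z: "z \<in> J" "z \<in> M" "z \<noteq> s"
        using calculation J Mtwo MX unfolding proper_interval_def by (metis subsetD)
      moreover from z(2) have zX: "z \<in> X" using MX by blast
      ultimately have "fst s < fst z" using s(2)[of z] genpos_fst_eq[OF X, of s z] s(1) MX by fastforce
      then have "p \<in> J"
        using interval_fstD[OF Jint(1) sJ z(1), of p] x0(1) x0(2)[OF zX] unfolding Y_def p_def by auto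
      then show False using no[OF J] by blast
    qed
    then show "J \<inter> {p, s} = {} \<and> J \<subseteq> X" using no[OF J] JX by blast
  qed (auto simp: Y_def)
  then show ?thesis unfolding extendable_def using Y avY Y_def by blast
qed

section \<open>Three-point cuts\<close>

text \<open>The points \<open>d\<close>, \<open>q\<close>, \<open>p\<close> of the proof sit around the northwest corner of \<open>M\<close>: reading left to right
  one meets \<open>d\<close>, \<open>q\<close>, the first point \<open>s\<close> of \<open>M\<close>, and \<open>p\<close>; reading upwards, the top of \<open>M\<close>, \<open>d\<close>, \<open>p\<close>,
  the lowest point \<open>u\<close> above \<open>M\<close>, and \<open>q\<close>. The only comparable pairs among the new points are \<open>d\<close>, \<open>q\<close> and \<open>d\<close>, \<open>p\<close>.\<close>

lemma diagonal_cut: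
  assumes X: "genpos X" and P: "genpos P" and av: "avoids P X"
    and cut: "P = K \<union> N" "southwest K N" "card K \<ge> 2" "card N \<ge> 2"
    and M: "maximal_interval X M"
    and noK: "\<And>K' N' A. P = K' \<union> N' \<Longrightarrow> southwest K' N' \<Longrightarrow> K' \<noteq> {} \<Longrightarrow> A \<subseteq> X \<Longrightarrow> occurrence K' A \<Longrightarrow> \<not> southwest A M"
    and noN: "\<And>K' N' B. P = K' \<union> N' \<Longrightarrow> southwest K' N' \<Longrightarrow> N' \<noteq> {} \<Longrightarrow> B \<subseteq> X \<Longrightarrow> occurrence N' B \<Longrightarrow> \<not> southwest M B"
    and u: "u \<in> X" "\<And>m. m \<in> M \<Longrightarrow> snd m < snd u"
      "\<And>z. z \<in> X \<Longrightarrow> (\<And>m. m \<in> M \<Longrightarrow> snd m < snd z) \<Longrightarrow> snd u \<le> snd z"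
    and l: "l \<in> X" "\<And>m. m \<in> M \<Longrightarrow> fst l < fst m"
      "\<And>z. z \<in> X \<Longrightarrow> (\<And>m. m \<in> M \<Longrightarrow> fst z < fst m) \<Longrightarrow> fst z \<le> fst l"
    and D: "\<And>A. occurrence K A \<Longrightarrow> \<not> A \<subseteq> {z \<in> X. (\<forall>m\<in>M. fst z < fst m) \<and> snd z \<le> snd u}"
  shows "extendable P X"
proof -
  have finX: "finite X" using X by (simp add: genpos_def)
  note Mprop = maximal_intervalD[OF M]
  note MX = Mprop(1,2) and Mint = Mprop(3) and Mtwo = Mprop(4) and Mcov = Mprop(5)
  have finM: "finite M" "M \<noteq> {}" using finX MX Mtwo finite_subset by blast+
  have genK: "genpos K" and genN: "genpos N"
    using P cut(1) genpos_subset by blast+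
  obtain s where s: "s \<in> M" "\<And>z. z \<in> M \<Longrightarrow> fst s \<le> fst z"
    using ex_least[OF finM, of fst] by blast
  obtain t where t: "t \<in> M" "\<And>z. z \<in> M \<Longrightarrow> snd z \<le> snd t"
    using ex_greatest[OF finM, of snd] by blast
  have sX: "s \<in> X" and tX: "t \<in> X" using s(1) t(1) MX by blast+
  obtain a b where ab: "a < b" "b < fst s" "\<And>z. z \<in> X \<Longrightarrow> fst z < fst s \<Longrightarrow> fst z < a"
    using gap_left[OF finX, of "fst s" fst] by blast
  obtain c where c: "fst s < c" "\<And>z. z \<in> X \<Longrightarrow> fst s < fst z \<Longrightarrow> c < fst z"
    using gap_right[OF finX, of "fst s" fst] by (meson less_trans)
  obtain e g where eg: "snd t < e" "e < g" "\<And>z. z \<in> X \<Longrightarrow> snd t < snd z \<Longrightarrow> g < snd z"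
    using gap_right[OF finX, of "snd t" snd] by blast
  obtain h where h: "snd u < h" "\<And>z. z \<in> X \<Longrightarrow> snd u < snd z \<Longrightarrow> h < snd z"
    using gap_right[OF finX, of "snd u" snd] by (meson less_trans)
  have ut: "snd t < snd u" "g < snd u" using u(1,2) t(1) eg(3) by blast+
  have above: "snd u \<le> snd z" "g < snd z" if "z \<in> X" "snd t < snd z" for z
  proof -
    show "g < snd z" using eg(3)[OF that] .
    show "snd u \<le> snd z" using u(3)[OF that(1)] t(2) that(2) by (meson le_less_trans)
  qed
  have eq_s: "z = s" if "z \<in> X" "fst z = fst s" for z
    using that genpos_fst_eq[OF X _ sX] by blast
  have left_M: "fst z < fst m" if "fst z < fst s" "m \<in> M" for z m
    using that s(2) by fastforce
  \<comment> \<open>As an interval, \<open>M\<close> admits no outside point in a row strictly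
    between two of its rows. So an outside point that is not above the top of \<open>M\<close> is
    below all of \<open>M\<close>; \<open>NE\<close> is the analogue for columns.\<close>
  have SW: "fst z < fst m \<and> snd z < snd m" if "z \<in> X" "fst z < fst s" "snd z \<le> snd t" "m \<in> M" for z m
  proof -
    have "z \<notin> M" using that(2) s(2) by fastforce
    then have "snd z \<noteq> snd t" "snd z \<noteq> snd m"
      using genpos_snd_eq[OF X that(1)] that(4) t(1) MX(1) by blast+
    moreover have "\<not> (snd m < snd z \<and> snd z < snd t)"
      using interval_sndD[OF Mint that(4) t(1) that(1)] \<open>z \<notin> M\<close> by blast
    ultimately show ?thesis using left_M that by fastforce
  qed
  have NE: "fst m < fst z \<and> snd m < snd z" if "z \<in> X" "fst s \<le> fst z" "snd t < snd z" "m \<in> M" for z m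
  proof -
    have "z \<notin> M" using that(3) t(2) by fastforce
    then have "fst z \<noteq> fst s" "fst z \<noteq> fst m"
      using genpos_fst_eq[OF X that(1)] that(4) s(1) MX(1) by blast+
    moreover have "\<not> (fst s < fst z \<and> fst z < fst m)"
      using interval_fstD[OF Mint s(1) that(4) that(1)] \<open>z \<notin> M\<close> by blast
    ultimately show ?thesis using t(2)[OF that(4)] that by fastforce
  qed
  define d q p where "d = (a, e)" and "q = (b, h)" and "p = (c, g)"
  have co [simp]: "fst d = a" "snd d = e" "fst q = b" "snd q = h" "fst p = c" "snd p = g"
    by (simp_all add: d_def q_def p_def)
  have eh: "g < h" "e < h" "a < fst s" "b < c" "a < c" "e < snd u" "snd t < g" "snd t < h"
    using ut eg ab c(1) h(1) by linarith+
  define Y where "Y = insert d (insert q (insert p X))"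
  have Ycases: "z = d \<or> z = q \<or> z = p \<or> z \<in> X" if "z \<in> Y" for z
    using that unfolding Y_def by blast
  have inY: "d \<in> Y" "q \<in> Y" "p \<in> Y" "X \<subseteq> Y" unfolding Y_def by blast+
  have fresh: "fst z \<noteq> a \<and> fst z \<noteq> b \<and> fst z \<noteq> c \<and> snd z \<noteq> e \<and> snd z \<noteq> g \<and> snd z \<noteq> h" if "z \<in> X" for z
    using ab(1,2) ab(3)[OF that] c(1) c(2)[OF that] eg(1,2) eg(3)[OF that] h(1) h(2)[OF that] by fastforce
  have Y: "genpos Y"
  proof -
    have 1: "genpos (insert p X)"
      by (rule genpos_insert[OF X]) (simp_all add: fresh)
    have 2: "genpos (insert q (insert p X))"
      by (rule genpos_insert[OF 1]; erule insertE) (use eh in \<open>simp_all add: fresh\<close>)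
    show ?thesis unfolding Y_def
      by (rule genpos_insert[OF 2]; elim insertE) (use eh eg ab(1) in \<open>simp_all add: fresh\<close>)
  qed
  have avY: "avoids P Y" unfolding avoids_def
  proof (intro allI impI notI)
    fix G assume G: "G \<subseteq> Y" "occurrence P G"
    obtain E F where EF: "G = E \<union> F" "occurrence K E" "occurrence N F" "southwest E F"
      using occurrence_split G(2) cut(1,2) by metis
    have E: "z = d \<or> z = q \<or> z = p \<or> z \<in> X" if "z \<in> E" for z using that Ycases G(1) EF(1) by blast
    have F: "z = d \<or> z = q \<or> z = p \<or> z \<in> X" if "z \<in> F" for z using that Ycases G(1) EF(1) by blast
    have lt: "fst x < fst y \<and> snd x < snd y" if "x \<in> E" "y \<in> F" for x y
      using EF(4) that unfolding southwest_def by blast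
    \<comment> \<open>The contradictions used below: \<open>alpha\<close> and \<open>beta\<close>
      apply \<open>noK\<close> and \<open>noN\<close> to the decomposition \<open>K\<close>,
      \<open>N\<close> itself, while \<open>alpha'\<close> and \<open>beta'\<close> first shift one
      extreme point \<open>r\<close> across it. The summand that loses a point stays nonempty by the
      bounds on \<open>card K\<close> and \<open>card N\<close>.\<close>
    have alpha: False if "\<And>z. z \<in> E \<Longrightarrow> z \<in> X \<and> fst z < fst s \<and> snd z \<le> snd t"
    proof -
      have "E \<subseteq> X" "southwest E M" using that SW unfolding southwest_def by blast+
      moreover have "K \<noteq> {}" using cut(3) by auto
      ultimately show False using noK[OF cut(1,2) _ _ EF(2)] by blast
    qed
    have beta: False if "\<And>z. z \<in> F \<Longrightarrow> z \<in> X \<and> fst s \<le> fst z \<and> snd t < snd z"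
    proof -
      have "F \<subseteq> X" "southwest M F" using that NE unfolding southwest_def by blast+
      moreover have "N \<noteq> {}" using cut(4) by auto
      ultimately show False using noN[OF cut(1,2) _ _ EF(3)] by blast
    qed
    have alpha': False if r: "r \<in> E" "\<And>z. z \<in> E \<Longrightarrow> z \<noteq> r \<Longrightarrow> z \<in> X \<and> fst z < fst s \<and> snd z \<le> snd t"
      "southwest (E - {r}) {r}" for r
    proof -
      obtain k where k: "k \<in> K" "southwest (K - {k}) {k}" "occurrence (K - {k}) (E - {r})"
        using occurrence_remove_last[OF genK EF(2) r(1,3)] by blast
      have "K - {k} \<noteq> {}"
      proof
        assume "K - {k} = {}"
        then have "K = {k}" using k(1) by blast
        then show False using cut(3) by simp
      qed
      moreover have "P = (K - {k}) \<union> insert k N" using cut(1) k(1) by blast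
      moreover have "southwest (K - {k}) (insert k N)" using k(2) cut(2) unfolding southwest_def by blast
      moreover have "E - {r} \<subseteq> X" "southwest (E - {r}) M" using r(2) SW unfolding southwest_def by blast+
      ultimately show False using noK k(3) by blast
    qed
    have beta': False if r: "r \<in> F" "\<And>z. z \<in> F \<Longrightarrow> z \<noteq> r \<Longrightarrow> z \<in> X \<and> fst s \<le> fst z \<and> snd t < snd z"
      "southwest {r} (F - {r})" for r
    proof -
      obtain k where k: "k \<in> N" "southwest {k} (N - {k})" "occurrence (N - {k}) (F - {r})"
        using occurrence_remove_first[OF genN EF(3) r(1,3)] by blast
      have "N - {k} \<noteq> {}"
      proof
        assume "N - {k} = {}"
        then have "N = {k}" using k(1) by blast
        then show False using cut(4) by simp
      qed
      moreover have "P = insert k K \<union> (N - {k})" using cut(1) k(1) by blast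
      moreover have "southwest (insert k K) (N - {k})" using k(2) cut(2) unfolding southwest_def by blast
      moreover have "F - {r} \<subseteq> X" "southwest M (F - {r})" using r(2) NE unfolding southwest_def by blast+
      ultimately show False using noN k(3) by blast
    qed
    have rightX: "fst s \<le> fst z" if "z \<in> X" "a < fst z" for z using ab(3)[OF that(1)] that(2) by linarith
    \<comment> \<open>Everything northeast of \<open>q\<close> is an old point northeast of
      \<open>M\<close>; the same holds for \<open>p\<close> in \<open>pE\<close>.\<close>
    have qE: "q \<notin> E"
    proof
      assume q: "q \<in> E"
      have "z \<in> X \<and> fst s \<le> fst z \<and> snd t < snd z" if z: "z \<in> F" for z
      proof -
        have l: "b < fst z" "h < snd z" using lt[OF q z] by simp_all
        then have "z \<noteq> d \<and> z \<noteq> q \<and> z \<noteq> p" using eh eg by auto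
        then have "z \<in> X" using F[OF z] by blast
        then show ?thesis using l rightX[of z] ab eh by force
      qed
      then show False by (rule beta)
    qed
    have pE: "p \<notin> E"
    proof
      assume p: "p \<in> E"
      have "z \<in> X \<and> fst s \<le> fst z \<and> snd t < snd z" if z: "z \<in> F" for z
      proof -
        have l: "c < fst z" "g < snd z" using lt[OF p z] by simp_all
        then have "z \<noteq> d \<and> z \<noteq> q \<and> z \<noteq> p" using eh eg by auto
        then have "z \<in> X" using F[OF z] by blast
        then show ?thesis using l rightX[of z] ab eh by force
      qed
      then show False by (rule beta)
    qed
    \<comment> \<open>Everything southwest of \<open>d\<close> is an old point southwest of
      \<open>M\<close>.\<close>
    have dF: "d \<notin> F"
    proof
      assume d: "d \<in> F"
      have "z \<in> X \<and> fst z < fst s \<and> snd z \<le> snd t" if z: "z \<in> E" for z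
      proof -
        have l: "fst z < a" "snd z < e" using lt[OF z d] by simp_all
        then have "z \<noteq> d" by auto
        then have "z \<in> X" using E[OF z] qE pE z by blast
        then show ?thesis using l above(2)[of z] ab eg by force
      qed
      then show False by (rule alpha)
    qed
    have dE: "z \<in> X \<longrightarrow> fst s \<le> fst z \<and> snd t < snd z" if "d \<in> E" "z \<in> F" for z
      using lt[OF that] rightX[of z] eg(1) by auto
    \<comment> \<open>Apart from \<open>d\<close>, the set \<open>E\<close> lies left of
      \<open>M\<close> and not above \<open>u\<close>. Without \<open>d\<close> it is excluded by
      \<open>D\<close>. With \<open>d\<close>, either \<open>u\<close> is in \<open>E\<close> and
      the rest of \<open>F\<close> is northeast of \<open>q\<close>, or the rest of \<open>E\<close>
      is southwest of \<open>d\<close>.\<close>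
    have qF: "q \<notin> F"
    proof
      assume q: "q \<in> F"
      have EX: "z = d \<or> z \<in> X \<and> fst z < fst s \<and> snd z \<le> snd u" if z: "z \<in> E" for z
        using E[OF z] qE pE z lt[OF z q] ab(2) h(2)[of z] by fastforce
      show False
      proof (cases "d \<in> E")
        case False
        then have "E \<subseteq> {z \<in> X. (\<forall>m\<in>M. fst z < fst m) \<and> snd z \<le> snd u}"
          using EX left_M by blast
        then show False using D EF(2) by blast
      next
        case dE': True
        show False
        proof (cases "u \<in> E")
          case True
          have *: "z \<in> X \<and> fst s \<le> fst z \<and> snd u < snd z" if z: "z \<in> F" "z \<noteq> q" for z
          proof -
            have "snd u < snd z" using lt[OF True z(1)] by blast
            moreover then have "z \<noteq> p" using ut by auto
            ultimately show ?thesis using F[OF z(1)] z dF dE[OF dE' z(1)] by blast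
          qed
          show False
          proof (rule beta'[OF q])
            have "b < fst z \<and> h < snd z" if "z \<in> F" "z \<noteq> q" for z
              using *[OF that] ab(2) h(2)[of z] by linarith
            then show "southwest {q} (F - {q})" by (simp add: southwest_def)
          qed (meson * less_trans ut(1))
        next
          case False
          have *: "z \<in> X \<and> fst z < fst s \<and> snd z \<le> snd t" if z: "z \<in> E" "z \<noteq> d" for z
          proof -
            have z': "z \<in> X" "fst z < fst s" "snd z \<le> snd u" using EX[OF z(1)] z(2) by blast+
            have "z \<noteq> u" using False z by blast
            then have "snd z \<noteq> snd u" using genpos_snd_eq[OF X z'(1) u(1)] by blast
            then show ?thesis using z' above(1)[OF z'(1)] by force
          qed
          show False
          proof (rule alpha'[OF dE'])
            have "fst z < a \<and> snd z < e" if "z \<in> E" "z \<noteq> d" for z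
              using *[OF that] ab(3)[of z] eg(1) by linarith
            then show "southwest (E - {d}) {d}" by (simp add: southwest_def)
          qed (use * in blast)
        qed
      qed
    qed
    \<comment> \<open>With \<open>d\<close> in \<open>E\<close>, the rest of \<open>F\<close> is
      northeast of \<open>p\<close>. Otherwise \<open>E\<close> is southwest of \<open>M\<close>,
      except possibly for \<open>s\<close>, which is then its greatest point.\<close>
    have pF: "p \<notin> F"
    proof
      assume p: "p \<in> F"
      have EX: "z = d \<or> z \<in> X \<and> fst z \<le> fst s \<and> snd z \<le> snd t" if z: "z \<in> E" for z
        using E[OF z] qE pE z lt[OF z p] c(2)[of z] eg(3)[of z] by fastforce
      show False
      proof (cases "d \<in> E")
        case True
        have *: "z \<in> X \<and> fst s < fst z \<and> snd t < snd z" if z: "z \<in> F" "z \<noteq> p" for z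
        proof -
          have z': "z \<in> X" using F[OF z(1)] z qF dF by blast
          then show ?thesis using dE[OF True z(1)] eq_s[OF z'] NE[of z s] s(1) by blast
        qed
        show False
        proof (rule beta'[OF p])
          have "c < fst z \<and> g < snd z" if "z \<in> F" "z \<noteq> p" for z
            using *[OF that] c(2)[of z] eg(3)[of z] by linarith
          then show "southwest {p} (F - {p})" by (simp add: southwest_def)
        qed (meson * less_imp_le)
      next
        case False
        have *: "z \<in> X \<and> fst z < fst s \<and> snd z \<le> snd t" if z: "z \<in> E" "z \<noteq> s" for z
        proof -
          have z': "z \<in> X" "fst z \<le> fst s" "snd z \<le> snd t" using EX[OF z(1)] z(1) False by blast+
          then show ?thesis using eq_s[OF z'(1)] z(2) by force
        qed
        show False
        proof (cases "s \<in> E")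
          case True
          show False
          proof (rule alpha'[OF True])
            show "southwest (E - {s}) {s}" using * SW[OF _ _ _ s(1)] unfolding southwest_def by blast
          qed (use * in blast)
        next
          case False
          show False by (rule alpha) (use * False in blast)
        qed
      qed
    qed
    have FX: "F \<subseteq> X" using F dF qF pF by blast
    show False
    proof (cases "d \<in> E")
      case True
      show False by (rule beta) (use dE[OF True] FX in blast)
    next
      case False
      then have "E \<subseteq> X" using E qE pE by blast
      then show False using FX G(2) EF(1) av unfolding avoids_def by blast
    qed
  qed
  have Yc: "z = d \<or> z = q \<or> z = p \<or> z = s \<or> z \<in> X \<and> fst z < fst s \<or> z \<in> X \<and> fst s < fst z"
    if "z \<in> Y" for z
    using Ycases[OF that] eq_s[of z] less_linear[of "fst z" "fst s"] by blast
  have unM: "u \<notin> M" using u(2) by blast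
  have sY: "s \<in> Y" and uY: "u \<in> Y" and lY: "l \<in> Y" using sX u(1) l(1) inY by blast+
  have ls: "fst l < fst s" using l(2) s(1) by blast
  obtain s2 where s2: "s2 \<in> M" "s2 \<noteq> s" using Mtwo by metis
  have s2X: "s2 \<in> X" using s2 MX by blast
  have ss2: "fst s < fst s2" using s(2)[OF s2(1)] eq_s[OF s2X] s2(2) by force
  have cs2: "c < fst s2" using c(2)[OF s2X ss2] .
  have st: "snd s \<le> snd t" using t(2)[OF s(1)] .
  \<comment> \<open>Each pair forces a further point into \<open>J\<close>: \<open>dp\<close> leads
    to \<open>sd\<close>, then to \<open>sq\<close>, then to \<open>su\<close>, and
    \<open>mp\<close> leads to \<open>dp\<close>. Once \<open>s\<close> and \<open>u\<close> are in
    \<open>J\<close>, so is \<open>X\<close>, and the columns of \<open>l\<close>, \<open>s\<close>,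
    \<open>s2\<close> enclose the three new points.\<close>
  have all: "J = Y" if J: "interval Y J" "x \<in> J" "y \<in> J" "x \<noteq> y" "x \<in> {d, q, p, s}" for J x y
  proof -
    have JY: "J \<subseteq> Y" using J(1) unfolding interval_def by blast
    note fstD = interval_fstD[OF J(1)] and sndD = interval_sndD[OF J(1)]
    have su: ?thesis if "s \<in> J" "u \<in> J"
    proof -
      have XJ: "X \<subseteq> J" using maximal_interval_spread[OF M inY(4) J(1) that(1) s(1) that(2) u(1) unM] .
      then have "l \<in> J" "s2 \<in> J" using l(1) s2X by blast+
      moreover have "fst l < a" using ab(3)[OF l(1) ls] .
      ultimately have "d \<in> J" "q \<in> J" "p \<in> J"
        using fstD[of l s d] fstD[of l s q] fstD[of s s2 p] that inY ab(1,2) c(1) cs2 by auto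
      then show ?thesis using XJ JY unfolding Y_def by blast
    qed
    have sq: ?thesis if "s \<in> J" "q \<in> J"
      using su sndD[of s q u] that uY st ut h(1) by simp
    have sd: ?thesis if "s \<in> J" "d \<in> J"
      using sq fstD[of d s q] that inY ab by simp
    have dp: ?thesis if "d \<in> J" "p \<in> J"
      using sd fstD[of d p s] that sY eh c(1) by simp
    have mp: ?thesis if "m \<in> J" "m \<in> M" "p \<in> J" for m
      using dp sndD[of m p d] that inY t(2)[OF that(2)] eg by simp
    have s1: ?thesis if "s \<in> J" "z \<in> J" "z \<noteq> s" for z
    proof -
      have zY: "z \<in> Y" using that JY by blast
      note zn = that(3)
      consider "z = d" | "z = q" | "z = p" | "z \<in> X" "fst z < fst s" | "z \<in> X" "fst s < fst z"
        using Yc[OF zY] zn by blast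
      then show ?thesis
      proof cases
        case 4
        then show ?thesis using sq fstD[of z s q] that inY ab(1,2) ab(3)[of z] by simp
      next
        case 5
        then show ?thesis using mp[of s] fstD[of s z p] that inY c(1) c(2)[of z] s(1) by simp
      qed (use that sd sq mp s(1) in blast)+
    qed
    have pz: ?thesis if "p \<in> J" "z \<in> J" "z \<noteq> p" for z
    proof -
      have zY: "z \<in> Y" using that JY by blast
      note zn = that(3)
      consider "z = d" | "z = q" | "z \<in> X" "fst z < fst s" | "z = s" | "z \<in> X" "fst s < fst z"
        using Yc[OF zY] zn by blast
      then show ?thesis
      proof cases
        case 1 then show ?thesis using dp that by blast
      next
        case 2
        then show ?thesis using mp[of s] fstD[of q p s] that sY ab(2) c(1) s(1) by simp
      next
        case 3
        then show ?thesis using mp[of s] fstD[of z p s] that sY c(1) s(1) by simp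
      next
        case 4
        then show ?thesis using mp[of s] s(1) that by blast
      next
        case 5
        show ?thesis
        proof (cases "z \<in> M")
          case False
          then have "\<not> fst z < fst s2" using interval_fstD[OF Mint s(1) s2(1)] 5 by blast
          moreover have "fst z \<noteq> fst s2" using genpos_fst_eq[OF X 5(1) s2X] False s2(1) by blast
          ultimately have "s2 \<in> J" using fstD[of p z s2] that cs2 s2X inY by force
          then show ?thesis using mp s2(1) that by blast
        qed (use mp that in blast)
      qed
    qed
    have qz: ?thesis if "q \<in> J" "z \<in> J" "z \<noteq> q" for z
    proof -
      have zY: "z \<in> Y" using that JY by blast
      note zn = that(3)
      consider "z = d" | "z = p" | "z \<in> X" "fst z < fst s" | "z = s" | "z \<in> X" "fst s < fst z"
        using Yc[OF zY] zn by blast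
      then show ?thesis
      proof cases
        case 1
        then show ?thesis using dp sndD[of d q p] that inY eg eh by simp
      next
        case 2 then show ?thesis using pz that by blast
      next
        case 3
        then have "d \<in> J" using fstD[of z q d] that inY ab(1) ab(3)[of z] by simp
        then show ?thesis using dp sndD[of d q p] that inY eg eh by simp
      next
        case 4 then show ?thesis using sq that by blast
      next
        case 5
        then show ?thesis using sq fstD[of q z s] that sY ab(2) by simp
      qed
    qed
    have dz: ?thesis if "d \<in> J" "z \<in> J" "z \<noteq> d" for z
    proof -
      have zY: "z \<in> Y" using that JY by blast
      note zn = that(3)
      consider "z = q" | "z = p" | "z \<in> X" "fst z < fst s" | "z = s" | "z \<in> X" "fst s < fst z"
        using Yc[OF zY] zn by blast
      then show ?thesis
      proof cases
        case 1 then show ?thesis using qz that by blast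
      next
        case 2 then show ?thesis using dp that by blast
      next
        case 3
        have "fst z \<le> fst l" using l(3)[OF 3(1)] left_M[OF 3(2)] by blast
        \<comment> \<open>No old column lies between \<open>l\<close> and \<open>d\<close>. If
          \<open>l\<close> is above the top of \<open>M\<close>, the row of \<open>p\<close> is
          between those of \<open>d\<close> and \<open>l\<close>; otherwise \<open>l\<close> is
          southwest of \<open>M\<close>, and the row of \<open>s\<close> is between them.\<close>
        have "l \<in> J"
        proof (cases "z = l")
          case False
          then have "fst z < fst l" using \<open>fst z \<le> fst l\<close> genpos_fst_eq[OF X 3(1) l(1)] by force
          then show ?thesis using fstD[of z d l] that lY ab(3)[OF l(1) ls] by simp
        qed (use that in blast)
        show ?thesis
        proof (cases "snd t < snd l")
          case True
          then have "p \<in> J" using sndD[of d l p] above(2)[OF l(1)] \<open>l \<in> J\<close> that inY eg by simp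
          then show ?thesis using dp that by blast
        next
          case False
          then have "snd l < snd s" using SW[OF l(1) ls _ s(1)] by simp
          then have "s \<in> J" using sndD[of l d s] \<open>l \<in> J\<close> that sY st eg(1) by simp
          then show ?thesis using sd that by blast
        qed
      next
        case 4 then show ?thesis using sd that by blast
      next
        case 5
        then show ?thesis using sd fstD[of d z s] that sY eh by simp
      qed
    qed
    show ?thesis using J(2-5) s1 pz qz dz by blast
  qed
  have "covered Y \<subset> covered X"
  proof (rule covered_psubset[of s X Y "{d, q, p, s}"])
    show "s \<in> covered X" using s(1) Mcov by blast
    show "X \<subseteq> Y" by (rule inY(4))
    show "s \<in> {d, q, p, s}" by blast
    fix J assume J: "proper_interval Y J"
    have Jint: "interval Y J" "J \<noteq> Y" "J \<subseteq> Y" using J unfolding proper_interval_def interval_def by blast+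
    have Jtwo: "\<exists>a\<in>J. \<exists>b\<in>J. a \<noteq> b" using J unfolding proper_interval_def by blast
    have no: "x \<notin> J" if "x \<in> {d, q, p, s}" for x
    proof
      assume "x \<in> J"
      moreover obtain y where "y \<in> J" "x \<noteq> y" using Jtwo by metis
      ultimately show False using all[OF Jint(1)] that Jint(2) by blast
    qed
    then show "J \<inter> {d, q, p, s} = {} \<and> J \<subseteq> X" using Jint(3) Ycases by blast
  qed
  then show ?thesis unfolding extendable_def using Y avY inY(4) by blast
qed

section \<open>Destroying all intervals\<close>

text \<open>Being left of \<open>M\<close>, the point is outside it, and an outside point cannot
  have a row strictly between two rows of \<open>M\<close>.\<close>

lemma left_and_below:
  assumes "genpos X" "interval X M" "z \<in> X" "\<And>m. m \<in> M \<Longrightarrow> fst z < fst m" "m0 \<in> M" "snd z \<le> snd m0" "m \<in> M"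
  shows "snd z < snd m"
proof -
  have "z \<notin> M" using assms(4) by blast
  have "M \<subseteq> X" using assms(2) unfolding interval_def by blast
  then have "snd z \<noteq> snd m0" "snd z \<noteq> snd m"
    using genpos_snd_eq[OF assms(1,3)] assms(5,7) \<open>z \<notin> M\<close> by blast+
  then show ?thesis
    using interval_sndD[OF assms(2,7,5,3)] \<open>z \<notin> M\<close> assms(6) by fastforce
qed

lemma above_and_right:
  assumes "genpos X" "interval X M" "z \<in> X" "\<And>m. m \<in> M \<Longrightarrow> snd m < snd z" "m0 \<in> M" "fst m0 \<le> fst z" "m \<in> M"
  shows "fst m < fst z"
proof -
  have "z \<notin> M" using assms(4) by blast
  have "M \<subseteq> X" using assms(2) unfolding interval_def by blast
  then have "fst z \<noteq> fst m0" "fst z \<noteq> fst m"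
    using genpos_fst_eq[OF assms(1,3)] assms(5,7) \<open>z \<notin> M\<close> by blast+
  then show ?thesis
    using interval_fstD[OF assms(2,5,7,3)] \<open>z \<notin> M\<close> assms(6) by fastforce
qed

text \<open>The guards in \<open>left\<close> and \<open>top\<close> provide the points
  \<open>l\<close> and \<open>u\<close> next to \<open>M\<close>, and the uncovered point that a
  maximal interval needs. When no cut and no reflected cut is available, the copies of
  \<open>K\<close> and \<open>N\<close> in the way contradict either \<open>av\<close> or the
  absence of copies southwest of \<open>M\<close>.\<close>

lemma extendable_if_guarded:
  assumes X: "genpos X" and P: "genpos P" and av: "avoids P X"
    and cut: "P = K \<union> N" "southwest K N" "card K \<ge> 2" "card N \<ge> 2"
    and nonempty: "covered X \<noteq> {}"
    and left: "\<And>z. z \<in> covered X \<Longrightarrow> \<exists>g\<in>X - covered X. fst g < fst z"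
    and top: "\<And>z. z \<in> covered X \<Longrightarrow> \<exists>g\<in>X - covered X. snd z < snd g"
  shows "extendable P X"
proof -
  have finX: "finite X" using X by (simp add: genpos_def)
  have "X - covered X \<noteq> {}" using nonempty left by blast
  then obtain M where M: "maximal_interval X M" using ex_maximal_interval X nonempty by blast
  note Mprop = maximal_intervalD[OF M]
  note MX = Mprop(1,2) and Mint = Mprop(3) and Mtwo = Mprop(4) and Mcov = Mprop(5)
  have finM: "finite M" "M \<noteq> {}" using finX MX Mtwo finite_subset by blast+
  show ?thesis
  proof (cases "\<exists>K' N' A. P = K' \<union> N' \<and> southwest K' N' \<and> K' \<noteq> {} \<and> A \<subseteq> X \<and> occurrence K' A \<and> southwest A M")
    case True
    then show ?thesis using vertical_cut[OF X P av _ _ _ _ _ _ M] by blast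
  next
    case noK: False
    show ?thesis
    proof (cases "\<exists>K' N' B. P = K' \<union> N' \<and> southwest K' N' \<and> N' \<noteq> {} \<and> B \<subseteq> X \<and> occurrence N' B \<and> southwest M B")
      case True
      then obtain K' N' B where h: "P = K' \<union> N'" "southwest K' N'" "N' \<noteq> {}" "B \<subseteq> X" "occurrence N' B" "southwest M B"
        by blast
      have "flip ` P = flip ` N' \<union> flip ` K'" using h(1) by blast
      then have "extendable (flip ` P) (flip ` X)"
        by (rule vertical_cut[of "flip ` X" "flip ` P" "flip ` N'" "flip ` K'" "flip ` B" "flip ` M", rotated 3])
          (use h X P av M in simp_all)
      then show ?thesis by (rule extendable_flip)
    next
      case noN: False
      have noK': "\<not> southwest A M" if "P = K' \<union> N'" "southwest K' N'" "K' \<noteq> {}" "A \<subseteq> X" "occurrence K' A" for K' N' A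
        using noK that by blast
      have noN': "\<not> southwest M B" if "P = K' \<union> N'" "southwest K' N'" "N' \<noteq> {}" "B \<subseteq> X" "occurrence N' B" for K' N' B
        using noN that by blast
      obtain s where s: "s \<in> M" "\<And>z. z \<in> M \<Longrightarrow> fst s \<le> fst z"
        using ex_least[OF finM, of fst] by blast
      obtain t where t: "t \<in> M" "\<And>z. z \<in> M \<Longrightarrow> snd z \<le> snd t"
        using ex_greatest[OF finM, of snd] by blast
      let ?U = "{z \<in> X. \<forall>m\<in>M. snd m < snd z}" and ?L = "{z \<in> X. \<forall>m\<in>M. fst z < fst m}"
      obtain g where "g \<in> X" "snd t < snd g" using top[of t] t(1) Mcov by blast
      then have "g \<in> ?U" using t(2) by (auto intro: le_less_trans)
      then have "finite ?U" "?U \<noteq> {}" using finX by (simp, blast)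
      then obtain u where u: "u \<in> ?U" "\<And>z. z \<in> ?U \<Longrightarrow> snd u \<le> snd z"
        using ex_least[of ?U snd] by blast
      obtain g' where "g' \<in> X" "fst g' < fst s" using left[of s] s(1) Mcov by blast
      then have "g' \<in> ?L" using s(2) by (auto intro: less_le_trans)
      then have "finite ?L" "?L \<noteq> {}" using finX by (simp, blast)
      then obtain l where l: "l \<in> ?L" "\<And>z. z \<in> ?L \<Longrightarrow> fst z \<le> fst l"
        using ex_greatest[of ?L fst] by blast
      show ?thesis
      proof (cases "\<exists>A. occurrence K A \<and> A \<subseteq> {z \<in> X. (\<forall>m\<in>M. fst z < fst m) \<and> snd z \<le> snd u}")
        case False
        show ?thesis
        proof (rule diagonal_cut[where u = u and l = l, OF X P av cut M noK' noN'])
          show "u \<in> X" "l \<in> X" using u(1) l(1) by blast+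
          show "snd m < snd u" if "m \<in> M" for m using u(1) that by blast
          show "fst l < fst m" if "m \<in> M" for m using l(1) that by blast
          show "snd u \<le> snd z" if "z \<in> X" "\<And>m. m \<in> M \<Longrightarrow> snd m < snd z" for z using u(2) that by blast
          show "fst z \<le> fst l" if "z \<in> X" "\<And>m. m \<in> M \<Longrightarrow> fst z < fst m" for z using l(2) that by blast
          show "\<not> A \<subseteq> {z \<in> X. (\<forall>m\<in>M. fst z < fst m) \<and> snd z \<le> snd u}" if "occurrence K A" for A
            using False that by blast
        qed
      next
        case True
        then obtain A where A: "occurrence K A" "A \<subseteq> {z \<in> X. (\<forall>m\<in>M. fst z < fst m) \<and> snd z \<le> snd u}" by blast
        show ?thesis
        proof (cases "\<exists>B. occurrence N B \<and> B \<subseteq> {z \<in> X. (\<forall>m\<in>M. snd m < snd z) \<and> fst l \<le> fst z}")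
          case False
          \<comment> \<open>Reflection exchanges \<open>l\<close> and \<open>u\<close>, as well as
            the two summands.\<close>
          have "extendable (flip ` P) (flip ` X)"
          proof (rule diagonal_cut[of "flip ` X" "flip ` P" "flip ` N" "flip ` K" "flip ` M" "flip l" "flip u"])
            show "flip ` P = flip ` N \<union> flip ` K" using cut(1) by blast
          next
            fix K' N' A assume h: "flip ` P = K' \<union> N'" "southwest K' N'" "K' \<noteq> {}" "A \<subseteq> flip ` X" "occurrence K' A"
            have "P = flip ` N' \<union> flip ` K'" using h(1) by (metis Un_commute flip_image_flip_image image_Un)
            moreover have "southwest (flip ` N') (flip ` K')" "flip ` A \<subseteq> X" "occurrence (flip ` K') (flip ` A)"
              using h flip_image_subset_iff[of A "flip ` X"] by simp_all
            ultimately have "\<not> southwest M (flip ` A)" using noN'[of "flip ` N'" "flip ` K'"] h(3) by blast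
            then show "\<not> southwest A (flip ` M)" using southwest_flip[of M "flip ` A"] southwest_flip[of "flip ` A" M] by simp
          next
            fix K' N' B assume h: "flip ` P = K' \<union> N'" "southwest K' N'" "N' \<noteq> {}" "B \<subseteq> flip ` X" "occurrence N' B"
            have "P = flip ` N' \<union> flip ` K'" using h(1) by (metis Un_commute flip_image_flip_image image_Un)
            moreover have "southwest (flip ` N') (flip ` K')" "flip ` B \<subseteq> X" "occurrence (flip ` N') (flip ` B)"
              using h flip_image_subset_iff[of B "flip ` X"] by simp_all
            ultimately have "\<not> southwest (flip ` B) M" using noK'[of "flip ` N'" "flip ` K'"] h(3) by blast
            then show "\<not> southwest (flip ` M) B" using southwest_flip[of "flip ` B" M] southwest_flip[of M "flip ` B"] by simp
          next
            fix A assume A: "occurrence (flip ` N) A"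
            have "occurrence N (flip ` A)" using A occurrence_flip[of N "flip ` A"] by simp
            then have "\<not> flip ` A \<subseteq> {z \<in> X. (\<forall>m\<in>M. snd m < snd z) \<and> fst l \<le> fst z}" using False by blast
            moreover have "flip z \<in> {z \<in> X. (\<forall>m\<in>M. snd m < snd z) \<and> fst l \<le> fst z}"
              if "z \<in> {z \<in> flip ` X. (\<forall>m\<in>flip ` M. fst z < fst m) \<and> snd z \<le> snd (flip l)}" for z
              using that by auto
            ultimately show "\<not> A \<subseteq> {z \<in> flip ` X. (\<forall>m\<in>flip ` M. fst z < fst m) \<and> snd z \<le> snd (flip l)}"
              by blast
          next
            fix z assume z: "z \<in> flip ` X" "\<And>m. m \<in> flip ` M \<Longrightarrow> snd m < snd z"
            have "fst (flip z) < fst m" if "m \<in> M" for m using z(2)[of "flip m"] that by simp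
            then have "flip z \<in> ?L" using z(1) by auto
            then show "snd (flip l) \<le> snd z" using l(2) by fastforce
          next
            fix z assume z: "z \<in> flip ` X" "\<And>m. m \<in> flip ` M \<Longrightarrow> fst z < fst m"
            have "snd m < snd (flip z)" if "m \<in> M" for m using z(2)[of "flip m"] that by simp
            then have "flip z \<in> ?U" using z(1) by auto
            then show "fst z \<le> fst (flip u)" using u(2) by fastforce
          qed (use X P av cut M u l in auto)
          then show ?thesis by (rule extendable_flip)
        next
          case True
          then obtain B where B: "occurrence N B" "B \<subseteq> {z \<in> X. (\<forall>m\<in>M. snd m < snd z) \<and> fst l \<le> fst z}" by blast
          have genK: "genpos K" using P cut(1) genpos_subset by blast
          have AX: "A \<subseteq> X" and BX: "B \<subseteq> X" using A(2) B(2) by blast+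
          \<comment> \<open>A point of \<open>A\<close> other than \<open>u\<close> is strictly
            lower than \<open>u\<close>, so by the choice of \<open>u\<close> it is not above all of
            \<open>M\<close>; being left of \<open>M\<close>, it is then southwest of it.\<close>
          have A': "fst z < fst m \<and> snd z < snd m" if "z \<in> A" "z \<noteq> u" "m \<in> M" for z m
          proof -
            have z: "z \<in> X" "\<And>m. m \<in> M \<Longrightarrow> fst z < fst m" "snd z \<le> snd u" using that(1) A(2) by blast+
            have "snd z \<noteq> snd u" using genpos_snd_eq[OF X z(1)] u(1) that(2) by blast
            then have "z \<notin> ?U" using u(2)[of z] z(3) by fastforce
            then obtain m0 where "m0 \<in> M" "snd z \<le> snd m0" using z(1) by (auto simp: not_less)
            then show ?thesis using left_and_below[OF X Mint z(1,2) _ _ that(3)] z(2) that(3) by blast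
          qed
          have B': "fst m < fst z \<and> snd m < snd z" if "z \<in> B" "z \<noteq> l" "m \<in> M" for z m
          proof -
            have z: "z \<in> X" "\<And>m. m \<in> M \<Longrightarrow> snd m < snd z" "fst l \<le> fst z" using that(1) B(2) by blast+
            have "fst z \<noteq> fst l" using genpos_fst_eq[OF X z(1)] l(1) that(2) by blast
            then have "z \<notin> ?L" using l(2)[of z] z(3) by fastforce
            then obtain m0 where "m0 \<in> M" "fst m0 \<le> fst z" using z(1) by (auto simp: not_less)
            then show ?thesis using above_and_right[OF X Mint z(1,2) _ _ that(3)] z(2) that(3) by blast
          qed
          have KN: "K \<noteq> {}" "N \<noteq> {}" using cut(3,4) by auto
          \<comment> \<open>Were \<open>u\<close> not in \<open>A\<close>, all of \<open>A\<close>
            would be southwest of \<open>M\<close>. Hence \<open>u\<close> also lies left of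
            \<open>M\<close>, and dually \<open>l\<close> lies above \<open>M\<close>.\<close>
          have uA: "u \<in> A"
          proof (rule ccontr)
            assume "u \<notin> A"
            then have "southwest A M" using A' unfolding southwest_def by blast
            then show False using noK'[OF cut(1,2) KN(1) AX A(1)] by blast
          qed
          have lB: "l \<in> B"
          proof (rule ccontr)
            assume "l \<notin> B"
            then have "southwest M B" using B' unfolding southwest_def by blast
            then show False using noN'[OF cut(1,2) KN(2) BX B(1)] by blast
          qed
          have lU: "l \<in> ?U" and uL: "u \<in> ?L" using uA lB A(2) B(2) by blast+
          have lX: "l \<in> X" and uX: "u \<in> X" using lU uL by blast+
          have Al: "fst z \<le> fst l" if "z \<in> A" for z using l(2)[of z] A(2) that by blast
          have Bu: "snd u \<le> snd z" if "z \<in> B" for z using u(2)[of z] B(2) that by blast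
          \<comment> \<open>If \<open>l = u\<close>, this point is the greatest of \<open>A\<close>
            and is shifted across the decomposition. Otherwise \<open>A\<close> is strictly left of
            \<open>l\<close> and \<open>B\<close> strictly above \<open>u\<close>, so
            \<open>A \<union> B\<close> is a copy of \<open>P\<close> inside
            \<open>X\<close>.\<close>
          have False
          proof (cases "l = u")
            case True
            have "fst z < fst u \<and> snd z < snd u" if "z \<in> A" "z \<noteq> u" for z
            proof -
              have "z \<in> X" "fst z \<le> fst u" "snd z \<le> snd u" using that(1) A(2) Al True by blast+
              moreover from this have "fst z \<noteq> fst u" "snd z \<noteq> snd u"
                using genpos_fst_eq[OF X _ uX] genpos_snd_eq[OF X _ uX] that(2) by blast+
              ultimately show ?thesis by simp
            qed
            then have "southwest (A - {u}) {u}" unfolding southwest_def by simp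
            then obtain k where k: "k \<in> K" "southwest (K - {k}) {k}" "occurrence (K - {k}) (A - {u})"
              using occurrence_remove_last[OF genK A(1) uA] by blast
            have "K - {k} \<noteq> {}"
            proof
              assume "K - {k} = {}"
              then have "K = {k}" using k(1) by blast
              then show False using cut(3) by simp
            qed
            moreover have "P = (K - {k}) \<union> insert k N" using cut(1) k(1) by blast
            moreover have "southwest (K - {k}) (insert k N)" using k(2) cut(2) unfolding southwest_def by blast
            moreover have "A - {u} \<subseteq> X" "southwest (A - {u}) M" using AX A' unfolding southwest_def by blast+
            ultimately show False using noK' k(3) by blast
          next
            case False
            have lu: "fst u < fst l" "snd u < snd l"
              using Al[OF uA] Bu[OF lB] False genpos_fst_eq[OF X lX uX] genpos_snd_eq[OF X lX uX] by fastforce+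
            have 1: "fst z < fst l \<and> snd z \<le> snd u" if "z \<in> A" for z
            proof -
              have "z \<in> X" "snd z \<le> snd u" using that A(2) by blast+
              moreover then have "z \<noteq> l" using lu by auto
              ultimately show ?thesis using Al[OF that] genpos_fst_eq[OF X _ lX, of z] by fastforce
            qed
            have 2: "fst l \<le> fst z \<and> snd u < snd z" if "z \<in> B" for z
            proof -
              have "z \<in> X" "fst l \<le> fst z" using that B(2) by blast+
              moreover then have "z \<noteq> u" using lu by auto
              ultimately show ?thesis using Bu[OF that] genpos_snd_eq[OF X _ uX, of z] by fastforce
            qed
            have "southwest A B" unfolding southwest_def using 1 2 by (meson le_less_trans less_le_trans)
            then have "occurrence P (A \<union> B)" using occurrence_join A(1) B(1) cut(1,2) by blast
            then show False using av AX BX unfolding avoids_def by blast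
          qed
          then show ?thesis ..
        qed
      qed
    qed
  qed
qed

text \<open>Induction on the number of covered points. The guards survive each extension, because
  points that are uncovered in \<open>X\<close> stay uncovered in \<open>Y\<close>.\<close>

lemma ex_simple_extension_if_guarded:
  assumes P: "genpos P" and cut: "P = K \<union> N" "southwest K N" "card K \<ge> 2" "card N \<ge> 2"
    and X: "genpos X" and av: "avoids P X"
    and left: "\<And>z. z \<in> covered X \<Longrightarrow> \<exists>g\<in>X - covered X. fst g < fst z"
    and top: "\<And>z. z \<in> covered X \<Longrightarrow> \<exists>g\<in>X - covered X. snd z < snd g"
  shows "\<exists>Y. X \<subseteq> Y \<and> genpos Y \<and> avoids P Y \<and> covered Y = {}"
  using X av left top
proof (induction "card (covered X)" arbitrary: X rule: less_induct)
  case less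
  show ?case
  proof (cases "covered X = {}")
    case False
    obtain Y where Y: "X \<subseteq> Y" "genpos Y" "avoids P Y" "covered Y \<subset> covered X"
      using extendable_if_guarded[OF less.prems(1) P less.prems(2) cut False less.prems(3,4)]
      unfolding extendable_def by blast
    have "finite (covered X)"
      using less.prems(1) covered_subset finite_subset unfolding genpos_def by blast
    then have "card (covered Y) < card (covered X)" using Y(4) by (rule psubset_card_mono)
    moreover have sub: "X - covered X \<subseteq> Y - covered Y" using Y by blast
    moreover have "\<exists>g\<in>Y - covered Y. fst g < fst z" if "z \<in> covered Y" for z
      using less.prems(3)[of z] Y(4) that sub by blast
    moreover have "\<exists>g\<in>Y - covered Y. snd z < snd g" if "z \<in> covered Y" for z
      using less.prems(4)[of z] Y(4) that sub by blast
    ultimately have "\<exists>Y'. Y \<subseteq> Y' \<and> genpos Y' \<and> avoids P Y' \<and> covered Y' = {}"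
      using less.hyps[OF _ Y(2,3)] by blast
    then show ?thesis using Y(1) by blast
  qed (use less.prems in blast)
qed

section \<open>Making a permutation indecomposable\<close>

text \<open>\<open>W\<close> is a union of initial skew components of \<open>Z\<close>.\<close>

definition skew_cut :: "pt set \<Rightarrow> pt set \<Rightarrow> bool" where
  "skew_cut Z W \<longleftrightarrow> W \<subseteq> Z \<and> W \<noteq> {} \<and> W \<noteq> Z \<and>
     (\<forall>w\<in>W. \<forall>v\<in>Z - W. fst w < fst v \<and> snd v < snd w)"

text \<open>With \<open>t\<close> the last point of \<open>W\<close> and \<open>s\<close> the first point of its complement, \<open>q t s p\<close> is a copy of 2413.
  The points \<open>q\<close> and \<open>p\<close> see too few points southwest and northeast of them to lie in a copy of the pattern.\<close>

lemma link_skew_cut: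
  assumes Z: "genpos Z" and P: "genpos P" and av: "avoids P Z"
    and cut: "P = K \<union> N" "southwest K N" "card K \<ge> 2" "card N \<ge> 2"
    and W: "skew_cut Z W"
  obtains q p t s where "t \<in> W" "s \<in> Z - W" "\<And>w. w \<in> W \<Longrightarrow> fst w \<le> fst t"
    "fst q < fst t" "fst s < fst p" "\<And>w. w \<in> W \<Longrightarrow> w \<noteq> t \<Longrightarrow> fst w < fst q"
    "\<And>v. v \<in> Z - W \<Longrightarrow> v \<noteq> s \<Longrightarrow> fst p < fst v"
    "\<And>w. w \<in> W \<Longrightarrow> snd p < snd w" "\<And>v. v \<in> Z - W \<Longrightarrow> snd v < snd q" "snd q < snd p"
    "genpos (insert q (insert p Z))" "avoids P (insert q (insert p Z))"
proof -
  have finZ: "finite Z" using Z by (simp add: genpos_def)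
  have WZ: "W \<subseteq> Z" "W \<noteq> {}" "Z - W \<noteq> {}"
    and NW: "\<And>w v. w \<in> W \<Longrightarrow> v \<in> Z - W \<Longrightarrow> fst w < fst v \<and> snd v < snd w"
    using W unfolding skew_cut_def by blast+
  have fin: "finite W" "finite (Z - W)" using finZ WZ finite_subset by blast+
  obtain t where t: "t \<in> W" "\<And>w. w \<in> W \<Longrightarrow> fst w \<le> fst t"
    using ex_greatest[OF fin(1) WZ(2), of fst] by blast
  obtain s where s: "s \<in> Z - W" "\<And>v. v \<in> Z - W \<Longrightarrow> fst s \<le> fst v"
    using ex_least[OF fin(2) WZ(3), of fst] by blast
  obtain o' where o': "o' \<in> W" "\<And>w. w \<in> W \<Longrightarrow> snd o' \<le> snd w"
    using ex_least[OF fin(1) WZ(2), of snd] by blast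
  obtain a where a: "a < fst t" "\<And>z. z \<in> Z \<Longrightarrow> fst z < fst t \<Longrightarrow> fst z < a"
    using gap_left[OF finZ, of "fst t" fst] by (meson less_trans)
  obtain c where c: "fst s < c" "\<And>z. z \<in> Z \<Longrightarrow> fst s < fst z \<Longrightarrow> c < fst z"
    using gap_right[OF finZ, of "fst s" fst] by (meson less_trans)
  \<comment> \<open>The rows \<open>e\<close> and \<open>g\<close> of the new points lie in the
    empty strip that separates \<open>Z - W\<close> from \<open>W\<close>.\<close>
  obtain e g where eg: "e < g" "g < snd o'" "\<And>z. z \<in> Z \<Longrightarrow> snd z < snd o' \<Longrightarrow> snd z < e"
    using gap_left[OF finZ, of "snd o'" snd] by blast
  define q p where "q = (a, e)" and "p = (c, g)"
  have co [simp]: "fst q = a" "snd q = e" "fst p = c" "snd p = g"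
    by (simp_all add: q_def p_def)
  have ts: "fst t < fst s" "a < c" using NW[OF t(1) s(1)] a(1) c(1) by linarith+
  have tZ: "t \<in> Z" and sZ: "s \<in> Z" using t(1) s(1) WZ by blast+
  have Wq: "fst w < a" if "w \<in> W" "w \<noteq> t" for w
    using a(2)[of w] t(2)[OF that(1)] genpos_fst_eq[OF Z _ tZ, of w] that WZ(1) by fastforce
  have Wp: "g < snd w" if "w \<in> W" for w using o'(2)[OF that] eg(2) by linarith
  have Vp: "c < fst v" if "v \<in> Z - W" "v \<noteq> s" for v
    using c(2)[of v] s(2)[OF that(1)] genpos_fst_eq[OF Z _ sZ, of v] that by fastforce
  have Vq: "snd v < e" if "v \<in> Z - W" for v using NW[OF o'(1) that] eg(3)[of v] that by blast
  have fresh: "fst z \<noteq> a \<and> fst z \<noteq> c \<and> snd z \<noteq> e \<and> snd z \<noteq> g" if "z \<in> Z" for z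
  proof (cases "z \<in> W")
    case True
    then show ?thesis using Wp[OF True] t(2)[OF True] a(1) a(2)[OF that] c(1) ts eg(1) by linarith
  next
    case False
    then have "z \<in> Z - W" using that by blast
    then show ?thesis using Vq[of z] s(2)[of z] a(1) c(1) c(2)[OF that] ts eg(1) by linarith
  qed
  define Y where "Y = insert q (insert p Z)"
  have Y: "genpos Y"
  proof -
    have 1: "genpos (insert p Z)"
      by (rule genpos_insert[OF Z]) (simp_all add: fresh)
    show ?thesis unfolding Y_def
      by (rule genpos_insert[OF 1]; elim insertE) (use ts(2) eg(1) in \<open>simp_all add: fresh\<close>)
  qed
  have avY: "avoids P Y" unfolding avoids_def
  proof (intro allI impI notI)
    fix G assume G: "G \<subseteq> Y" "occurrence P G"
    obtain E F where EF: "G = E \<union> F" "occurrence K E" "occurrence N F" "southwest E F"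
      using occurrence_split G(2) cut(1,2) by metis
    have E: "z = q \<or> z = p \<or> z \<in> W \<or> z \<in> Z - W" if "z \<in> E" for z
      using that G(1) EF(1) unfolding Y_def by blast
    have F: "z = q \<or> z = p \<or> z \<in> W \<or> z \<in> Z - W" if "z \<in> F" for z
      using that G(1) EF(1) unfolding Y_def by blast
    have lt: "fst x < fst y \<and> snd x < snd y" if "x \<in> E" "y \<in> F" for x y
      using EF(4) that unfolding southwest_def by blast
    have genK: "genpos K" and genN: "genpos N" using P cut(1) genpos_subset by blast+
    have cE: "card E \<ge> 2" "finite E" using occurrence_card[OF genK EF(2)] cut(3) by simp_all
    have cF: "card F \<ge> 2" "finite F" using occurrence_card[OF genN EF(3)] cut(4) by simp_all
    have no1: False if "card S \<ge> 2" "S \<subseteq> {x}" for x and S :: "pt set"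
      using card_mono[OF _ that(2)] that(1) by simp
    have both: "x \<in> S" "y \<in> S" if "card S \<ge> 2" "S \<subseteq> {x, y}" for x y and S :: "pt set"
      using no1[OF that(1), of x] no1[OF that(1), of y] that(2) by blast+
    \<comment> \<open>Only \<open>t\<close> and \<open>p\<close> are northeast of \<open>q\<close>,
      so \<open>F\<close> contains both; but southwest of both there is only \<open>q\<close>, too
      little for \<open>E\<close>.\<close>
    have qE: "q \<notin> E"
    proof
      assume q: "q \<in> E"
      have "z \<in> {t, p}" if "z \<in> F" for z
        using lt[OF q that] F[OF that] Wq[of z] Vq[of z] by auto
      then have "F \<subseteq> {t, p}" by blast
      then have tp: "t \<in> F" "p \<in> F" using both[OF cF(1)] by blast+
      have "z \<in> {q}" if "z \<in> E" for z
      proof -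
        have "fst z < fst t" "snd z < g" using lt[OF that tp(1)] lt[OF that tp(2)] by simp_all
        then show ?thesis using E[OF that] Wp[of z] s(2)[of z] ts c(1) by auto
      qed
      then show False using no1[OF cE(1), of q] by blast
    qed
    have pE: "p \<notin> E"
    proof
      assume p: "p \<in> E"
      have False if "z \<in> F" for z
        using lt[OF p that] F[OF that] t(2)[of z] Vq[of z] ts c(1) eg(1) by auto
      then show False using cF(1) by (metis all_not_in_conv card.empty not_numeral_le_zero)
    qed
    have qF: "q \<notin> F"
    proof
      assume q: "q \<in> F"
      have False if "z \<in> E" for z
        using lt[OF that q] E[OF that] qE pE that Wp[of z] s(2)[of z] ts a(1) eg(1) by auto
      then show False using cE(1) by (metis all_not_in_conv card.empty not_numeral_le_zero)
    qed
    \<comment> \<open>Besides \<open>q\<close>, only \<open>s\<close> is southwest of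
      \<open>p\<close>.\<close>
    have pF: "p \<notin> F"
    proof
      assume p: "p \<in> F"
      have "z \<in> {s}" if "z \<in> E" for z
        using lt[OF that p] E[OF that] qE pE that Wp[of z] Vp[of z] by auto
      then show False using no1[OF cE(1), of s] by blast
    qed
    have "G \<subseteq> Z" using EF(1) E F qE pE qF pF WZ(1) by blast
    then show False using G(2) av unfolding avoids_def by blast
  qed
  show ?thesis
    by (rule that[of t s q p]) (use t s a(1) c(1) Wq Vp Wp Vq eg(1) Y avY in \<open>simp_all add: Y_def\<close>)
qed

lemma finite_skew_cuts: "finite Z \<Longrightarrow> finite {W. skew_cut Z W}"
  by (rule finite_subset[of _ "Pow Z"]) (auto simp: skew_cut_def)

text \<open>Pairs of points separated by a skew cut are decreasing.\<close>

lemma skew_cut_same_side: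
  assumes "skew_cut Y W" "x \<in> Y" "y \<in> Y" "fst x < fst y" "snd x < snd y"
  shows "x \<in> W \<longleftrightarrow> y \<in> W"
  using assms unfolding skew_cut_def by (metis DiffI order_less_asym)

text \<open>Induction on the number of skew cuts. After linking along \<open>W\<close>, the points
  \<open>q\<close>, \<open>t\<close>, \<open>s\<close>, \<open>p\<close> are on one side of every
  skew cut of \<open>Y\<close>. So a skew cut of \<open>Y\<close> is determined by its trace on
  \<open>Z\<close>, and this trace is a skew cut of \<open>Z\<close> other than
  \<open>W\<close>.\<close>

lemma ex_skew_indecomposable_extension:
  assumes P: "genpos P" and cut: "P = K \<union> N" "southwest K N" "card K \<ge> 2" "card N \<ge> 2"
    and Z: "genpos Z" and av: "avoids P Z"
  shows "\<exists>Y. Z \<subseteq> Y \<and> genpos Y \<and> avoids P Y \<and> (\<forall>W. \<not> skew_cut Y W)"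
  using Z av
proof (induction "card {W. skew_cut Z W}" arbitrary: Z rule: less_induct)
  case less
  show ?case
  proof (cases "\<exists>W. skew_cut Z W")
    case True
    then obtain W where W: "skew_cut Z W" by blast
    obtain q p t s where link: "t \<in> W" "s \<in> Z - W"
      "fst q < fst t" "fst s < fst p"
      "\<And>w. w \<in> W \<Longrightarrow> snd p < snd w" "\<And>v. v \<in> Z - W \<Longrightarrow> snd v < snd q" "snd q < snd p"
      "genpos (insert q (insert p Z))" "avoids P (insert q (insert p Z))"
      using link_skew_cut[OF less.prems(1) P less.prems(2) cut W] by metis
    define Y where "Y = insert q (insert p Z)"
    have sub: "W \<subseteq> Z" and NW: "fst t < fst s" using W link(1,2) unfolding skew_cut_def by blast+
    have inY: "q \<in> Y" "p \<in> Y" "t \<in> Y" "s \<in> Y" "Z \<subseteq> Y" using link(1,2) sub unfolding Y_def by blast+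
    have side: "q \<in> V \<longleftrightarrow> t \<in> V" "p \<in> V \<longleftrightarrow> t \<in> V" "s \<in> V \<longleftrightarrow> t \<in> V" if "skew_cut Y V" for V
    proof -
      have qt: "q \<in> V \<longleftrightarrow> t \<in> V"
        using skew_cut_same_side[OF that inY(1,3)] link(3) link(5)[OF link(1)] link(7) by simp
      have qp: "q \<in> V \<longleftrightarrow> p \<in> V"
        using skew_cut_same_side[OF that inY(1,2)] link(3,4,7) NW by simp
      have sp: "s \<in> V \<longleftrightarrow> p \<in> V"
        using skew_cut_same_side[OF that inY(4,2)] link(4,7) link(6)[OF link(2)] by simp
      show "q \<in> V \<longleftrightarrow> t \<in> V" "p \<in> V \<longleftrightarrow> t \<in> V" "s \<in> V \<longleftrightarrow> t \<in> V" using qt qp sp by blast+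
    qed
    have tZ: "t \<in> Z" using link(1) sub by blast
    have "inj_on (\<lambda>V. V \<inter> Z) {V. skew_cut Y V}"
    proof (rule inj_onI)
      fix V V' assume V: "V \<in> {V. skew_cut Y V}" "V' \<in> {V. skew_cut Y V}" "V \<inter> Z = V' \<inter> Z"
      have "t \<in> V \<longleftrightarrow> t \<in> V'" using V(3) tZ by blast
      then have "q \<in> V \<longleftrightarrow> q \<in> V'" "p \<in> V \<longleftrightarrow> p \<in> V'" using side V by blast+
      moreover have "V \<subseteq> Y" "V' \<subseteq> Y" using V unfolding skew_cut_def by blast+
      ultimately show "V = V'" using V(3) unfolding Y_def by blast
    qed
    moreover have "(\<lambda>V. V \<inter> Z) ` {V. skew_cut Y V} \<subseteq> {V. skew_cut Z V} - {W}"
    proof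
      fix U assume "U \<in> (\<lambda>V. V \<inter> Z) ` {V. skew_cut Y V}"
      then obtain V where V: "skew_cut Y V" "U = V \<inter> Z" by blast
      have VY: "V \<subseteq> Y" "V \<noteq> {}" "V \<noteq> Y"
        and VNW: "\<And>w v. w \<in> V \<Longrightarrow> v \<in> Y - V \<Longrightarrow> fst w < fst v \<and> snd v < snd w"
        using V(1) unfolding skew_cut_def by blast+
      \<comment> \<open>A skew cut with no point of \<open>Z\<close> would contain \<open>q\<close>
        or \<open>p\<close>, hence also \<open>t\<close>; its complement is treated
        likewise.\<close>
      have "U \<noteq> {}" using VY(1,2) side[OF V(1)] tZ unfolding V(2) Y_def by blast
      moreover have "U \<noteq> Z" using VY(1,3) side[OF V(1)] tZ unfolding V(2) Y_def by blast
      moreover have "fst w < fst v \<and> snd v < snd w" if "w \<in> U" "v \<in> Z - U" for w v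
        using VNW[of w v] that inY(5) unfolding V(2) by blast
      ultimately have "skew_cut Z U" unfolding skew_cut_def using V(2) by blast
      moreover have "U \<noteq> W" using side(3)[OF V(1)] link(1,2) tZ unfolding V(2) by blast
      ultimately show "U \<in> {V. skew_cut Z V} - {W}" by blast
    qed
    moreover have finc: "finite {V. skew_cut Z V}"
      using less.prems(1) by (intro finite_skew_cuts) (simp add: genpos_def)
    ultimately have "card {V. skew_cut Y V} \<le> card ({V. skew_cut Z V} - {W})"
      by (meson card_inj_on_le finite_Diff)
    also have "\<dots> < card {V. skew_cut Z V}"
      using W finc by (intro psubset_card_mono) auto
    finally have "\<exists>Y'. Y \<subseteq> Y' \<and> genpos Y' \<and> avoids P Y' \<and> (\<forall>W. \<not> skew_cut Y' W)"
      using less.hyps link(8,9) unfolding Y_def by blast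
    then show ?thesis using inY(5) by blast
  qed (use less.prems in blast)
qed

text \<open>A corner point \<open>c\<close> northwest of everything is a skew component of its own;
  linking it to \<open>Z\<close> adds \<open>q\<close> and \<open>p\<close>. The guards are the
  leftmost point \<open>q\<close> and the topmost point \<open>c\<close>: an interval with one of
  them and a further point contains both, and then everything.\<close>

lemma ex_guarded_extension:
  assumes P: "genpos P" and cut: "P = K \<union> N" "southwest K N" "card K \<ge> 2" "card N \<ge> 2"
    and Z: "genpos Z" and av: "avoids P Z" and ne: "Z \<noteq> {}" and indec: "\<And>W. \<not> skew_cut Z W"
  shows "\<exists>Y. Z \<subseteq> Y \<and> genpos Y \<and> avoids P Y \<and> (\<exists>g\<in>Y - covered Y. \<forall>z\<in>Y - {g}. fst g < fst z)
     \<and> (\<exists>g\<in>Y - covered Y. \<forall>z\<in>Y - {g}. snd z < snd g)"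
proof -
  have finZ: "finite Z" using Z by (simp add: genpos_def)
  obtain lz where lz: "lz \<in> Z" "\<And>z. z \<in> Z \<Longrightarrow> fst lz \<le> fst z"
    using ex_least[OF finZ ne, of fst] by blast
  obtain tz where tz: "tz \<in> Z" "\<And>z. z \<in> Z \<Longrightarrow> snd z \<le> snd tz"
    using ex_greatest[OF finZ ne, of snd] by blast
  define c where "c = (fst lz - 1, snd tz + 1)"
  have cZ: "fst c < fst z \<and> snd z < snd c" if "z \<in> Z" for z
    using lz(2)[OF that] tz(2)[OF that] by (simp add: c_def)
  define Z1 where "Z1 = insert c Z"
  have cnZ: "c \<notin> Z" using cZ by blast
  have Z1: "genpos Z1" unfolding Z1_def using cZ by (intro genpos_insert[OF Z]) fastforce+
  have av1: "avoids P Z1" unfolding avoids_def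
  proof (intro allI impI notI)
    fix G assume G: "G \<subseteq> Z1" "occurrence P G"
    obtain E F where EF: "G = E \<union> F" "occurrence K E" "occurrence N F" "southwest E F"
      using occurrence_split G(2) cut(1,2) by metis
    have genK: "genpos K" and genN: "genpos N" using P cut(1) genpos_subset by blast+
    have "card E \<ge> 2" "card F \<ge> 2"
      using occurrence_card[OF genK EF(2)] occurrence_card[OF genN EF(3)] cut(3,4) by simp_all
    then have "E \<noteq> {}" "F \<noteq> {}" by auto
    then obtain x y where xy: "x \<in> E" "y \<in> F" by blast
    \<comment> \<open>No point is northeast or southwest of \<open>c\<close>, whereas both parts of
      the copy are nonempty.\<close>
    have "c \<notin> E"
    proof
      assume "c \<in> E"
      then have "fst c < fst y \<and> snd c < snd y" using EF(4) xy(2) unfolding southwest_def by blast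
      moreover have "y \<in> Z1" using G(1) EF(1) xy(2) by blast
      ultimately show False using cZ[of y] unfolding Z1_def by fastforce
    qed
    moreover have "c \<notin> F"
    proof
      assume "c \<in> F"
      then have "fst x < fst c \<and> snd x < snd c" using EF(4) xy(1) unfolding southwest_def by blast
      moreover have "x \<in> Z1" using G(1) EF(1) xy(1) by blast
      ultimately show False using cZ[of x] unfolding Z1_def by fastforce
    qed
    ultimately have "G \<subseteq> Z" using G(1) EF(1) unfolding Z1_def by blast
    then show False using G(2) av unfolding avoids_def by blast
  qed
  have "skew_cut Z1 {c}" unfolding skew_cut_def Z1_def using cZ cnZ ne by blast
  then obtain q p t s where link: "t \<in> {c}" "s \<in> Z1 - {c}"
    "fst q < fst t" "fst s < fst p"
    "\<And>w. w \<in> {c} \<Longrightarrow> snd p < snd w" "\<And>v. v \<in> Z1 - {c} \<Longrightarrow> snd v < snd q" "snd q < snd p"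
    "genpos (insert q (insert p Z1))" "avoids P (insert q (insert p Z1))"
    using link_skew_cut[OF Z1 P av1 cut] by metis
  define Y where "Y = insert q (insert p Z1)"
  have Yeq: "Y = insert q (insert p (insert c Z))" unfolding Y_def Z1_def ..
  have ZZ: "Z1 - {c} = Z" using cnZ unfolding Z1_def by blast
  have sZ: "s \<in> Z" using link(2) ZZ by blast
  have f: "fst q < fst c" "fst c < fst s" "fst s < fst p" "snd q < snd p" "snd p < snd c"
    using link(1,3-5,7) cZ[OF sZ] by auto
  have below: "snd v < snd q" if "v \<in> Z" for v using link(6) that ZZ by blast
  have inY: "q \<in> Y" "p \<in> Y" "c \<in> Y" "s \<in> Y" "Z \<subseteq> Y" using sZ unfolding Yeq by blast+
  have qleft: "fst q < fst z" if "z \<in> Y - {q}" for z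
    using that f cZ[of z] unfolding Yeq by fastforce
  have ctop: "snd z < snd c" if "z \<in> Y - {c}" for z
    using that f cZ[of z] unfolding Yeq by fastforce
  have both: "J = Y" if J: "interval Y J" "q \<in> J" "c \<in> J" for J
  proof -
    have JY: "J \<subseteq> Y" using J(1) unfolding interval_def by blast
    note fstD = interval_fstD[OF J(1)] and sndD = interval_sndD[OF J(1)]
    have pJ: "p \<in> J" using sndD[of q c p] J inY f by blast
    have sJ: "s \<in> J" using fstD[of q p s] J inY f pJ by fastforce
    \<comment> \<open>A missing point \<open>v\<close> further left than \<open>w\<close> would be
      between \<open>q\<close> and \<open>w\<close>, and one higher than \<open>w\<close> would be
      between \<open>w\<close> and \<open>c\<close>. So \<open>J \<inter> Z\<close> would be a skew
      cut unless it is \<open>Z\<close>.\<close>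
    have "fst w < fst v \<and> snd v < snd w" if "w \<in> J \<inter> Z" "v \<in> Z - (J \<inter> Z)" for w v
    proof -
      have v: "v \<in> Z" "v \<notin> J" "v \<in> Y" "v \<noteq> w" and w: "w \<in> J" "w \<in> Z" using that inY(5) by blast+
      have "\<not> fst v < fst w" using fstD[of q w v] qleft[of v] v w J(2) by blast
      moreover have "\<not> snd w < snd v" using sndD[of w c v] cZ[OF v(1)] v w J(3) by blast
      moreover have "fst v \<noteq> fst w" "snd v \<noteq> snd w"
        using genpos_fst_eq[OF Z v(1) w(2)] genpos_snd_eq[OF Z v(1) w(2)] v(4) by blast+
      ultimately show ?thesis by linarith
    qed
    then have "J \<inter> Z = Z" using indec[of "J \<inter> Z"] sJ sZ unfolding skew_cut_def by blast
    then show ?thesis using JY J(2,3) pJ unfolding Yeq by blast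
  qed
  have q: "q \<notin> covered Y"
  proof
    assume "q \<in> covered Y"
    then obtain J where J: "proper_interval Y J" "q \<in> J" unfolding covered_def by blast
    have Ji: "interval Y J" "J \<subseteq> Y" "J \<noteq> Y" and two: "\<exists>a\<in>J. \<exists>b\<in>J. a \<noteq> b"
      using J(1) unfolding proper_interval_def interval_def by blast+
    obtain z where z: "z \<in> J" "z \<noteq> q" using two by metis
    \<comment> \<open>The column of \<open>c\<close> comes directly after that of
      \<open>q\<close>.\<close>
    have "z = c \<or> fst c < fst z" using z Ji(2) f cZ[of z] unfolding Yeq by fastforce
    then have "c \<in> J" using interval_fstD[OF Ji(1) J(2) z(1) inY(3)] f z(1) by blast
    then show False using both[OF Ji(1) J(2)] Ji(3) by blast
  qed
  have c: "c \<notin> covered Y"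
  proof
    assume "c \<in> covered Y"
    then obtain J where J: "proper_interval Y J" "c \<in> J" unfolding covered_def by blast
    have Ji: "interval Y J" "J \<subseteq> Y" "J \<noteq> Y" and two: "\<exists>a\<in>J. \<exists>b\<in>J. a \<noteq> b"
      using J(1) unfolding proper_interval_def interval_def by blast+
    obtain z where z: "z \<in> J" "z \<noteq> c" using two by metis
    have qZ: "q \<in> J" if "v \<in> J" "v \<in> Z" for v
      using interval_sndD[OF Ji(1) that(1) J(2) inY(1)] below[OF that(2)] f by linarith
    \<comment> \<open>The row of \<open>q\<close> lies between \<open>c\<close> and each point of
      \<open>Z\<close>; the point \<open>p\<close> brings in \<open>s\<close> through its
      column.\<close>
    have "q \<in> J"
    proof (cases "z = p")
      case True
      then have "s \<in> J" using interval_fstD[OF Ji(1) J(2) z(1) inY(4)] f by blast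
      then show ?thesis using qZ sZ by blast
    next
      case False
      then show ?thesis using z Ji(2) qZ unfolding Yeq by blast
    qed
    then show False using both[OF Ji(1) _ J(2)] Ji(3) by blast
  qed
  have "\<exists>g\<in>Y - covered Y. \<forall>z\<in>Y - {g}. fst g < fst z" using q inY(1) qleft by blast
  moreover have "\<exists>g\<in>Y - covered Y. \<forall>z\<in>Y - {g}. snd z < snd g" using c inY(3) ctop by blast
  ultimately show ?thesis using inY(5) link(8,9) unfolding Y_def by blast
qed

theorem ex_simple_extension:
  assumes P: "genpos P" and cut: "P = K \<union> N" "southwest K N" "card K \<ge> 2" "card N \<ge> 2"
    and Z: "genpos Z" and av: "avoids P Z" and ne: "Z \<noteq> {}"
  shows "\<exists>Y. Z \<subseteq> Y \<and> genpos Y \<and> avoids P Y \<and> covered Y = {}"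
proof -
  obtain Z1 where Z1: "Z \<subseteq> Z1" "genpos Z1" "avoids P Z1" "\<And>W. \<not> skew_cut Z1 W"
    using ex_skew_indecomposable_extension[OF P cut Z av] by blast
  obtain Z2 g h where Z2: "Z1 \<subseteq> Z2" "genpos Z2" "avoids P Z2"
    and g: "g \<in> Z2 - covered Z2" "\<And>z. z \<in> Z2 - {g} \<Longrightarrow> fst g < fst z"
    and h: "h \<in> Z2 - covered Z2" "\<And>z. z \<in> Z2 - {h} \<Longrightarrow> snd z < snd h"
    using ex_guarded_extension[OF P cut Z1(2,3) _ Z1(4)] ne Z1(1) by blast
  have "\<exists>g\<in>Z2 - covered Z2. fst g < fst z" if "z \<in> covered Z2" for z
    using g that covered_subset[of Z2] by blast
  moreover have "\<exists>g\<in>Z2 - covered Z2. snd z < snd g" if "z \<in> covered Z2" for z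
    using h that covered_subset[of Z2] by blast
  ultimately obtain Y where "Z2 \<subseteq> Y" "genpos Y" "avoids P Y" "covered Y = {}"
    using ex_simple_extension_if_guarded[OF P cut Z2(2,3)] by blast
  then show ?thesis using Z1(1) Z2(1) by blast
qed

section \<open>Permutations as point sets\<close>

lemma occurrence_sym:
  assumes "genpos P" "occurrence P A"
  shows "occurrence A P"
proof -
  obtain f where f: "A = f ` P" "\<And>a b. a \<in> P \<Longrightarrow> b \<in> P \<Longrightarrow>
     (fst a < fst b \<longleftrightarrow> fst (f a) < fst (f b)) \<and> (snd a < snd b \<longleftrightarrow> snd (f a) < snd (f b))"
    using assms(2) unfolding occurrence_def by blast
  have inj: "inj_on f P" using f(2) by (intro order_reflecting_inj[OF assms(1)]) blast
  show ?thesis unfolding occurrence_def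
  proof (intro exI[of _ "inv_into P f"] conjI ballI)
    show "P = inv_into P f ` A" unfolding f(1) using inj by simp
  qed (use f inj in \<open>auto simp: inv_into_f_f\<close>)
qed

lemma occurrence_subset:
  assumes "occurrence P A" "Q \<subseteq> P"
  obtains B where "B \<subseteq> A" "occurrence Q B"
proof -
  obtain f where "A = f ` P" "\<forall>a\<in>P. \<forall>b\<in>P.
     (fst a < fst b \<longleftrightarrow> fst (f a) < fst (f b)) \<and> (snd a < snd b \<longleftrightarrow> snd (f a) < snd (f b))"
    using assms(1) unfolding occurrence_def by blast
  then have "f ` Q \<subseteq> A" "occurrence Q (f ` Q)" using assms(2) unfolding occurrence_def by blast+
  then show ?thesis using that by blast
qed

lemma occurrence_trans:
  assumes "occurrence P A" "occurrence A B"
  shows "occurrence P B"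
proof -
  obtain f where f: "A = f ` P" "\<forall>a\<in>P. \<forall>b\<in>P.
     (fst a < fst b \<longleftrightarrow> fst (f a) < fst (f b)) \<and> (snd a < snd b \<longleftrightarrow> snd (f a) < snd (f b))"
    using assms(1) unfolding occurrence_def by blast
  obtain g where g: "B = g ` A" "\<forall>a\<in>A. \<forall>b\<in>A.
     (fst a < fst b \<longleftrightarrow> fst (g a) < fst (g b)) \<and> (snd a < snd b \<longleftrightarrow> snd (g a) < snd (g b))"
    using assms(2) unfolding occurrence_def by blast
  show ?thesis unfolding occurrence_def
    by (rule exI[of _ "\<lambda>x. g (f x)"]) (use f g in \<open>auto simp: image_image\<close>)
qed

section \<open>Containment of lists as occurrence of plots\<close>

definition plot :: "nat list \<Rightarrow> pt set" where
  "plot xs = (\<lambda>i. (real i, real (xs ! i))) ` {..<length xs}"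

lemma is_perm_iff: "is_perm xs \<longleftrightarrow> set xs = {1..length xs} \<and> distinct xs"
  unfolding is_perm_def permutations_of_set_def by blast

lemma genpos_plot: "distinct xs \<Longrightarrow> genpos (plot xs)"
  unfolding genpos_def plot_def by (auto simp: inj_on_def nth_eq_iff_index_eq)

lemma subseq_indices:
  assumes "subseq xs ys"
  shows "\<exists>f. (\<forall>i<length xs. f i < length ys \<and> ys ! f i = xs ! i)
    \<and> (\<forall>i<length xs. \<forall>j<length xs. i < j \<longrightarrow> f i < (f j :: nat))"
  using assms
proof (induction rule: list_emb.induct)
  case (list_emb_Cons xs ys y)
  then obtain f where f: "\<forall>i<length xs. f i < length ys \<and> ys ! f i = xs ! i"
    "\<forall>i<length xs. \<forall>j<length xs. i < j \<longrightarrow> f i < (f j :: nat)" by blast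
  then show ?case by (intro exI[of _ "\<lambda>i. Suc (f i)"]) simp
next
  case (list_emb_Cons2 x y xs ys)
  then obtain f where f: "\<forall>i<length xs. f i < length ys \<and> ys ! f i = xs ! i"
    "\<forall>i<length xs. \<forall>j<length xs. i < j \<longrightarrow> f i < (f j :: nat)" by blast
  show ?case
    by (rule exI[of _ "\<lambda>i. case i of 0 \<Rightarrow> 0 | Suc k \<Rightarrow> Suc (f k)"])
      (use f list_emb_Cons2 in \<open>auto simp: nth_Cons split: nat.splits\<close>)
qed simp

text \<open>The chosen indices increase, so they arise from \<open>[0..<length ys]\<close> by
  filtering; mapping indices to entries preserves subsequences.\<close>

lemma subseq_map_nth:
  assumes "\<And>i. i < k \<Longrightarrow> f i < length ys" "\<And>i j. i < k \<Longrightarrow> j < k \<Longrightarrow> i < j \<Longrightarrow> f i < (f j :: nat)"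
  shows "subseq (map (\<lambda>i. ys ! f i) [0..<k]) ys"
proof -
  let ?xs = "map f [0..<k]" and ?ns = "[0..<length ys]"
  have sub: "set ?xs \<subseteq> set ?ns" using assms(1) by auto
  have srt: "sorted_wrt (<) ?xs"
    using assms(2) by (auto simp: sorted_wrt_iff_nth_less)
  have "filter (\<lambda>y. y \<in> set ?xs) ?ns = ?xs"
  proof (rule sorted_distinct_set_unique)
    show "sorted ?xs" "distinct ?xs" using srt strict_sorted_iff by blast+
    show "set (filter (\<lambda>y. y \<in> set ?xs) ?ns) = set ?xs" using sub by auto
  qed (simp_all add: sorted_wrt_filter)
  then have "subseq ?xs ?ns" by (metis subseq_filter_left)
  then have "subseq (map ((!) ys) ?xs) (map ((!) ys) ?ns)" by (rule subseq_map)
  then show ?thesis by (simp add: map_nth comp_def)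
qed

lemma contained_in_iff_occurrence:
  "contained_in \<alpha> \<beta> \<longleftrightarrow> (\<exists>A\<subseteq>plot \<beta>. occurrence (plot \<alpha>) A)"
proof
  assume "contained_in \<alpha> \<beta>"
  then obtain \<gamma> where \<gamma>: "subseq \<gamma> \<beta>" "length \<gamma> = length \<alpha>"
    "\<And>i j. i < length \<alpha> \<Longrightarrow> j < length \<alpha> \<Longrightarrow> \<gamma> ! i < \<gamma> ! j \<longleftrightarrow> \<alpha> ! i < \<alpha> ! j"
    unfolding contained_in_def order_iso_def by metis
  obtain f where f: "\<And>i. i < length \<alpha> \<Longrightarrow> f i < length \<beta> \<and> \<beta> ! f i = \<gamma> ! i"
    "\<And>i j. i < length \<alpha> \<Longrightarrow> j < length \<alpha> \<Longrightarrow> i < j \<Longrightarrow> f i < (f j :: nat)"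
    using subseq_indices[OF \<gamma>(1)] unfolding \<gamma>(2) by blast
  have f2: "f i < f j \<longleftrightarrow> i < j" if "i < length \<alpha>" "j < length \<alpha>" for i j
    using f(2)[of i j] f(2)[of j i] that by (metis linorder_neqE_nat order_less_asym order_less_irrefl)
  \<comment> \<open>The floor recovers the list index from the first coordinate of a plotted
    point.\<close>
  define F where "F p = (real (f (nat \<lfloor>fst p\<rfloor>)), real (\<beta> ! f (nat \<lfloor>fst p\<rfloor>)))" for p :: pt
  have "F ` plot \<alpha> \<subseteq> plot \<beta>" using f(1) unfolding F_def plot_def by auto
  moreover have "occurrence (plot \<alpha>) (F ` plot \<alpha>)" unfolding occurrence_def
    by (rule exI[of _ F]) (use f2 f(1) \<gamma>(3) in \<open>auto simp: plot_def F_def\<close>)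
  ultimately show "\<exists>A\<subseteq>plot \<beta>. occurrence (plot \<alpha>) A" by blast
next
  assume "\<exists>A\<subseteq>plot \<beta>. occurrence (plot \<alpha>) A"
  then obtain F where F: "F ` plot \<alpha> \<subseteq> plot \<beta>" "\<And>a b. a \<in> plot \<alpha> \<Longrightarrow> b \<in> plot \<alpha> \<Longrightarrow>
     (fst a < fst b \<longleftrightarrow> fst (F a) < fst (F b)) \<and> (snd a < snd b \<longleftrightarrow> snd (F a) < snd (F b))"
    unfolding occurrence_def by blast
  let ?p = "\<lambda>i. (real i, real (\<alpha> ! i))"
  have p: "?p i \<in> plot \<alpha>" if "i < length \<alpha>" for i using that unfolding plot_def by blast
  have "\<forall>i<length \<alpha>. \<exists>k<length \<beta>. F (?p i) = (real k, real (\<beta> ! k))"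
    using p F(1) unfolding plot_def by blast
  then obtain f where f: "\<And>i. i < length \<alpha> \<Longrightarrow> f i < length \<beta> \<and> F (?p i) = (real (f i), real (\<beta> ! f i))"
    by metis
  have ord: "(i < j \<longleftrightarrow> f i < f j) \<and> (\<alpha> ! i < \<alpha> ! j \<longleftrightarrow> \<beta> ! f i < \<beta> ! f j)"
    if "i < length \<alpha>" "j < length \<alpha>" for i j
    using F(2)[OF p p, OF that] f[OF that(1)] f[OF that(2)] by simp
  let ?g = "map (\<lambda>i. \<beta> ! f i) [0..<length \<alpha>]"
  have "subseq ?g \<beta>" by (rule subseq_map_nth) (use f ord less_trans in blast)+
  moreover have "order_iso ?g \<alpha>" unfolding order_iso_def using ord by simp
  ultimately show "contained_in \<alpha> \<beta>" unfolding contained_in_def by blast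
qed

section \<open>Standardization of a point set to a permutation\<close>

lemma rank_bij:
  fixes g :: "pt \<Rightarrow> real"
  assumes "finite X" "inj_on g X"
  defines "r \<equiv> \<lambda>z. card {w \<in> X. g w < g z}"
  shows "bij_betw r X {..<card X}" "\<And>y z. y \<in> X \<Longrightarrow> z \<in> X \<Longrightarrow> r y < r z \<longleftrightarrow> g y < g z"
proof -
  have mono: "r y < r z" if "y \<in> X" "z \<in> X" "g y < g z" for y z
    unfolding r_def using assms(1) that by (intro psubset_card_mono) auto
  show iff: "r y < r z \<longleftrightarrow> g y < g z" if "y \<in> X" "z \<in> X" for y z
  proof -
    have "g y = g z \<Longrightarrow> r y = r z" by (simp add: r_def)
    then show ?thesis using mono[OF that] mono[OF that(2,1)] less_linear[of "g y" "g z"] by auto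
  qed
  have inj: "inj_on r X"
  proof (rule inj_onI)
    fix y z assume yz: "y \<in> X" "z \<in> X" "r y = r z"
    then have "g y = g z" using mono[of y z] mono[of z y] less_linear[of "g y" "g z"] by auto
    then show "y = z" using assms(2) yz unfolding inj_on_def by blast
  qed
  have "r z < card X" if "z \<in> X" for z
    unfolding r_def using assms(1) that by (intro psubset_card_mono) auto
  then have "r ` X \<subseteq> {..<card X}" by blast
  moreover have "card (r ` X) = card X" using inj by (rule card_image)
  ultimately have "r ` X = {..<card X}" by (simp add: card_subset_eq)
  then show "bij_betw r X {..<card X}" using inj unfolding bij_betw_def by blast
qed

text \<open>Both coordinates are replaced by ranks. A list interval then pulls back to an interval
  of \<open>X\<close>, so an empty covered set gives simplicity.\<close>

lemma ex_perm_of_points: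
  assumes X: "genpos X"
  obtains \<tau> where "is_perm \<tau>" "occurrence X (plot \<tau>)" "covered X = {} \<Longrightarrow> simple_perm \<tau>"
proof -
  have fin: "finite X" "inj_on fst X" "inj_on snd X" using X unfolding genpos_def by blast+
  define n where "n = card X"
  define rx where "rx z = card {w \<in> X. fst w < fst z}" for z :: pt
  define ry where "ry z = card {w \<in> X. snd w < snd z}" for z :: pt
  have rx: "bij_betw rx X {..<n}" "\<And>y z. y \<in> X \<Longrightarrow> z \<in> X \<Longrightarrow> rx y < rx z \<longleftrightarrow> fst y < fst z"
    using rank_bij[OF fin(1,2)] unfolding rx_def[abs_def] n_def by blast+
  have ry: "bij_betw ry X {..<n}" "\<And>y z. y \<in> X \<Longrightarrow> z \<in> X \<Longrightarrow> ry y < ry z \<longleftrightarrow> snd y < snd z"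
    using rank_bij[OF fin(1,3)] unfolding ry_def[abs_def] n_def by blast+
  \<comment> \<open>Ranks start at 0, as list positions do, while the entries of a permutation start
    at 1; hence the \<open>Suc\<close>.\<close>
  define \<tau> where "\<tau> = map (\<lambda>i. Suc (ry (inv_into X rx i))) [0..<n]"
  have len: "length \<tau> = n" by (simp add: \<tau>_def)
  have injx: "inj_on rx X" and imx: "rx ` X = {..<n}" and injy: "inj_on ry X" and imy: "ry ` X = {..<n}"
    using rx(1) ry(1) unfolding bij_betw_def by blast+
  have rxn: "rx z < n" if "z \<in> X" for z using imx that by blast
  have nth: "\<tau> ! rx z = Suc (ry z)" if "z \<in> X" for z
    using rxn[OF that] that injx by (simp add: \<tau>_def inv_into_f_f)
  have "set \<tau> = (\<lambda>i. \<tau> ! i) ` {..<n}" unfolding set_conv_nth len by blast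
  also have "\<dots> = (\<lambda>z. Suc (ry z)) ` X" unfolding imx[symmetric] using nth by (force simp: image_image)
  also have "\<dots> = Suc ` {..<n}" unfolding imy[symmetric] by (simp add: image_image)
  also have "\<dots> = {1..n}" by (simp add: lessThan_atLeast0 image_Suc_atLeastLessThan atLeastLessThanSuc_atLeastAtMost)
  finally have set\<tau>: "set \<tau> = {1..length \<tau>}" unfolding len .
  then have dist: "distinct \<tau>" by (simp add: card_distinct)
  have perm: "is_perm \<tau>" using set\<tau> dist by (simp add: is_perm_iff)
  have plot: "plot \<tau> = (\<lambda>z. (real (rx z), real (Suc (ry z)))) ` X"
    unfolding plot_def len imx[symmetric] image_image using nth by (intro image_cong) simp_all
  have occurrence: "occurrence X (plot \<tau>)" unfolding occurrence_def
    by (rule exI[of _ "\<lambda>z. (real (rx z), real (Suc (ry z)))"]) (use plot rx(2) ry(2) in simp)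
  have "simple_perm \<tau>" if nb: "covered X = {}"
    unfolding simple_perm_def
  proof (intro conjI allI impI)
    show "is_perm \<tau>" by (rule perm)
  next
    fix I assume I: "perm_interval \<tau> I"
    obtain i j a b where ij: "I = {i..j}" "(\<lambda>k. \<tau> ! k) ` I = {a..b}" "I \<noteq> {}" "I \<subset> {..<n}"
      using I unfolding perm_interval_def len by blast
    define J where "J = {z \<in> X. rx z \<in> I}"
    have IX: "I \<subseteq> rx ` X" using ij(4) unfolding imx by (rule psubset_imp_subset)
    have IJ: "I = rx ` J"
    proof
      show "I \<subseteq> rx ` J" using IX unfolding J_def by auto
      show "rx ` J \<subseteq> I" unfolding J_def by auto
    qed
    have "interval X J" unfolding interval_def
    proof (intro conjI ballI impI)
      show "J \<subseteq> X" unfolding J_def by blast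
    next
      fix z x y assume z: "z \<in> X" and x: "x \<in> J" and y: "y \<in> J"
        and h: "fst x < fst z \<and> fst z < fst y \<or> snd x < snd z \<and> snd z < snd y"
      have xy: "x \<in> X" "y \<in> X" "rx x \<in> I" "rx y \<in> I" using x y unfolding J_def by blast+
      show "z \<in> J"
      proof (cases "fst x < fst z \<and> fst z < fst y")
        case True
        then have "rx x < rx z" "rx z < rx y" using rx(2) z xy by blast+
        then show ?thesis using z xy unfolding J_def ij(1) by simp
      next
        case False
        then have "ry x < ry z" "ry z < ry y" using h ry(2) z xy by blast+
        moreover have "\<tau> ! rx x \<in> {a..b}" "\<tau> ! rx y \<in> {a..b}" using xy(3,4) ij(2) by blast+
        ultimately have "\<tau> ! rx z \<in> {a..b}" using nth z xy(1,2) by simp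
        then obtain k where k: "k \<in> I" "\<tau> ! k = \<tau> ! rx z" using ij(2) by (metis imageE)
        have "k = rx z" using k dist rxn[OF z] ij(4) by (metis len lessThan_iff nth_eq_iff_index_eq psubsetD)
        then show ?thesis using z k(1) unfolding J_def by blast
      qed
    qed
    moreover have "J \<noteq> X"
    proof
      assume "J = X"
      then show False using ij(4) unfolding IJ imx[symmetric] by simp
    qed
    \<comment> \<open>Two different points would make \<open>J\<close> a proper interval, although
      nothing is covered.\<close>
    ultimately have one: "x = y" if "x \<in> J" "y \<in> J" for x y
      using nb that unfolding covered_def proper_interval_def by blast
    obtain x where "x \<in> J" using IJ ij(3) by blast
    then have "J = {x}" using one by blast
    then show "card I = 1" using IJ by simp
  qed
  then show ?thesis using that perm occurrence by blast
qed

lemma plot_perm_sum: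
  assumes "is_perm lam" "is_perm rho"
  obtains K N where "plot (lam \<oplus> rho) = K \<union> N" "southwest K N" "card K = length lam" "card N = length rho"
proof -
  let ?\<pi> = "lam \<oplus> rho" and ?k = "length lam" and ?n = "length lam + length rho"
  let ?p = "\<lambda>i. (real i, real (?\<pi> ! i))"
  have len: "length ?\<pi> = ?n" by (simp add: perm_sum_def)
  have inj: "inj_on ?p S" for S by (simp add: inj_on_def)
  have lo: "?\<pi> ! i \<le> ?k" if "i < ?k" for i
  proof -
    have "lam ! i \<in> {1..?k}" using assms(1) that nth_mem unfolding is_perm_iff by blast
    then show ?thesis using that by (simp add: perm_sum_def nth_append)
  qed
  have hi: "?k < ?\<pi> ! i" if "?k \<le> i" "i < ?n" for i
  proof -
    have "i - ?k < length rho" using that by linarith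
    then have "rho ! (i - ?k) \<in> {1..length rho}" using assms(2) nth_mem unfolding is_perm_iff by blast
    then show ?thesis using that by (simp add: perm_sum_def nth_append)
  qed
  have "{..<?n} = {..<?k} \<union> {?k..<?n}" by auto
  then have "plot ?\<pi> = ?p ` {..<?k} \<union> ?p ` {?k..<?n}"
    unfolding plot_def len by (simp add: image_Un)
  moreover have "southwest (?p ` {..<?k}) (?p ` {?k..<?n})"
    unfolding southwest_def using le_less_trans[OF lo hi] by auto
  moreover have "card (?p ` {..<?k}) = length lam" "card (?p ` {?k..<?n}) = length rho"
    by (simp_all add: card_image[OF inj])
  ultimately show ?thesis using that by blast
qed

lemma is_perm_perm_sum:
  assumes "is_perm lam" "is_perm rho"
  shows "is_perm (lam \<oplus> rho)"
proof -
  have "(\<lambda>b. b + length lam) ` {1..length rho} = {length lam + 1..length lam + length rho}"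
    by (simp add: add.commute[of _ "length rho"])
  then have "set (lam \<oplus> rho) = {1..length lam} \<union> {length lam + 1..length lam + length rho}"
    using assms by (simp only: perm_sum_def is_perm_iff set_append set_map)
  also have "\<dots> = {1..length (lam \<oplus> rho)}" by (auto simp: perm_sum_def)
  finally have "set (lam \<oplus> rho) = {1..length (lam \<oplus> rho)}" .
  then show ?thesis by (simp add: is_perm_iff card_distinct)
qed

section \<open>Simple extensions of permutations and non-deflatability\<close>

lemma ex_simple_perm_containing:
  assumes lr: "is_perm lam" "is_perm rho" "length lam \<ge> 2" "length rho \<ge> 2"
    and \<alpha>: "\<alpha> \<in> Av (lam \<oplus> rho)" "\<alpha> \<noteq> []"
  obtains \<sigma> where "\<sigma> \<in> Av (lam \<oplus> rho)" "simple_perm \<sigma>" "contained_in \<alpha> \<sigma>"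
proof -
  let ?\<pi> = "lam \<oplus> rho"
  obtain K N where KN: "plot ?\<pi> = K \<union> N" "southwest K N" "card K \<ge> 2" "card N \<ge> 2"
    using plot_perm_sum[OF lr(1,2)] lr(3,4) by metis
  have d\<pi>: "distinct ?\<pi>" using is_perm_perm_sum[OF lr(1,2)] by (simp add: is_perm_iff)
  have d\<alpha>: "distinct \<alpha>" and nc: "\<not> contained_in ?\<pi> \<alpha>"
    using \<alpha>(1) by (simp_all add: Av_def is_perm_iff)
  have av: "avoids (plot ?\<pi>) (plot \<alpha>)"
    using nc contained_in_iff_occurrence unfolding avoids_def by blast
  have ne: "plot \<alpha> \<noteq> {}" using \<alpha>(2) by (auto simp: plot_def)
  obtain Y where Y: "plot \<alpha> \<subseteq> Y" "genpos Y" "avoids (plot ?\<pi>) Y" "covered Y = {}"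
    using ex_simple_extension[OF genpos_plot[OF d\<pi>] KN genpos_plot[OF d\<alpha>] av ne] by blast
  obtain \<sigma> where \<sigma>: "is_perm \<sigma>" "occurrence Y (plot \<sigma>)" "simple_perm \<sigma>"
    using ex_perm_of_points[OF Y(2)] Y(4) by blast
  obtain B where "B \<subseteq> plot \<sigma>" "occurrence (plot \<alpha>) B" using occurrence_subset[OF \<sigma>(2) Y(1)] by blast
  then have "contained_in \<alpha> \<sigma>" using contained_in_iff_occurrence by blast
  moreover have "\<not> contained_in ?\<pi> \<sigma>"
  proof
    assume "contained_in ?\<pi> \<sigma>"
    then obtain A where A: "A \<subseteq> plot \<sigma>" "occurrence (plot ?\<pi>) A" using contained_in_iff_occurrence by blast
    obtain B where "B \<subseteq> Y" "occurrence A B" using occurrence_subset[OF occurrence_sym[OF Y(2) \<sigma>(2)] A(1)] by blast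
    then show False using occurrence_trans[OF A(2)] Y(3) unfolding avoids_def by blast
  qed
  ultimately show ?thesis using that \<sigma> unfolding Av_def by blast
qed

theorem theorem3p2:
  fixes lam rho \<pi> :: "nat list"
  assumes "is_perm lam" and "is_perm rho"
    and "length lam \<ge> 2" and "length rho \<ge> 2"
    and "\<pi> = lam \<oplus> rho"
  shows "\<not> deflatable (Av \<pi>)"
proof
  assume "deflatable (Av \<pi>)"
  then obtain D where D: "perm_class D" "D \<subset> Av \<pi>" "Av \<pi> \<subseteq> subst_closure D"
    unfolding deflatable_def by blast
  have closed: "\<alpha> \<in> D" if "\<beta> \<in> D" "is_perm \<alpha>" "contained_in \<alpha> \<beta>" for \<alpha> \<beta>
    using D(1) that unfolding perm_class_def by blast
  \<comment> \<open>The permutation lies in one of the classes united in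
    \<open>subst_closure D\<close>, and that class has the same simple permutations as
    \<open>D\<close>.\<close>
  have simple: "\<sigma> \<in> D" if "\<sigma> \<in> Av \<pi>" "simple_perm \<sigma>" for \<sigma>
    using D(3) that unfolding subst_closure_def simples_def by blast
  have nonempty: "\<alpha> \<in> D" if "\<alpha> \<in> Av \<pi>" "\<alpha> \<noteq> []" for \<alpha>
  proof -
    note \<alpha> = that[unfolded assms(5)]
    obtain \<sigma> where "\<sigma> \<in> Av \<pi>" "simple_perm \<sigma>" "contained_in \<alpha> \<sigma>"
      using ex_simple_perm_containing[OF assms(1-4) \<alpha>] unfolding assms(5) by blast
    then show ?thesis using simple closed that(1) by (auto simp: Av_def)
  qed
  \<comment> \<open>The empty permutation is outside the scope of the extension result; it is
    reached as a permutation contained in \<open>[1]\<close>, which avoids \<open>\<pi>\<close>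
    because \<open>\<pi>\<close> is longer.\<close>
  have "\<not> contained_in \<pi> [1]"
  proof
    assume "contained_in \<pi> [1]"
    then obtain \<gamma> :: "nat list" where "subseq \<gamma> [1]" "length \<gamma> = length \<pi>"
      unfolding contained_in_def order_iso_def by metis
    then have "length \<pi> \<le> length [1 :: nat]" using list_emb_length by metis
    then show False using assms(3-5) by (simp add: perm_sum_def)
  qed
  then have "[1] \<in> Av \<pi>" by (simp add: Av_def is_perm_iff)
  then have "[1] \<in> D" using nonempty by blast
  moreover have "contained_in [] [1]" by (simp add: contained_in_def order_iso_def)
  ultimately have "[] \<in> D" using closed by (simp add: is_perm_iff)
  then have "Av \<pi> \<subseteq> D" using nonempty by blast
  then show False using D(2) by blast
qed

end
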